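(* For any integers $n\ge 1$ and $m\ge 0$ and any $n$-simplex $T$, the set $D_T^{(m,n)}$ is $P_T^{(m,n)}$-unisolvent, i.e. the map $P_T^{(m,n)}\to\mathbb{R}^{D_T^{(m,n)}}$, $v\mapsto (d(v))_{d\in D_T^{(m,n)}}$, is a bijection.
   Context: Let $m\ge 0$, $n\ge 1$ be integers and $L=\lfloor m/(n+1)\rfloor$. Let $T$ be a (nondegenerate) $n$-simplex in $\mathbb{R}^n$; $\mathcal{P}_k(T)$ denotes the polynomials on $T$ of degree at most $k$, and $P_T^{(m,n)}:=\mathcal{P}_m(T)$. For $0\le k\le n$, $\mathcal{F}_{T,k}$ is the set of all $(n-k)$-dimensional sub-simplices of $T$. For $F\in\mathcal{F}_{T,k}$ with $1\le k\le n$, $|F|$ is its $(n-k)$-dimensional measure ($|F|=1$ and $\int_F$ is point evaluation when $F$ is a vertex, $k=n$), and $\nu_{F,1},\dots,\nu_{F,k}$ are fixed linearly independent unit vectors orthogonal to the tangent space of $F$. For $1\le k\le n$, $A_k$ is the set of $n$-dimensional multi-indices $\alpha=(\alpha_1,\dots,\alpha_n)$ with $\sum_{i=k+1}^n\alpha_i=0$. For $v\in H^m(T)$ set $$d_{T,F,\alpha}(v):=\frac1{|F|}\int_F\frac{\partial^{|\alpha|}v}{\partial\nu_{F,1}^{\alpha_1}\cdots\partial\nu_{F,k}^{\alpha_k}},\qquad d_{T,0}(v):=\frac1{|T|}\int_T v.$$ For $0\le\ell\le L$ define $$\tilde D_{T,\ell}^{(m,n)}:=\{d_{T,F,\alpha}\;:\;F\in\mathcal{F}_{T,k},\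 1\le k\le\min\{n,m-(n+1)(L-\ell)\},\ \alpha\in A_k,\ |\alpha|=m-k-(n+1)(L-\ell)\},$$ and define $\tilde D_{T,-1}^{(m,n)}:=\{d_{T,0}\}$ if $m\equiv 0\pmod{n+1}$ and $\tilde D_{T,-1}^{(m,n)}:=\varnothing$ otherwise. The set of degrees of freedom is $D_T^{(m,n)}:=\bigcup_{\ell=-1}^{L}\tilde D_{T,\ell}^{(m,n)}$. *)

theory Defs
  imports "HOL-Analysis.Analysis"
begin

text \<open>Elements of \<open>\<P>\<^sub>m(T)\<close> are represented by polynomial functions on the whole space. As \<open>T\<close> is
  nondegenerate, restriction to \<open>T\<close> is injective on them, and in this form their derivatives at
  boundary points of \<open>T\<close> are unambiguous.\<close>

definition poly_space :: "nat \<Rightarrow> (real^'n \<Rightarrow> real) set" where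
  "poly_space m = {\<lambda>x. \<Sum>\<beta> | (\<Sum>i\<in>UNIV. \<beta> i) \<le> m. c \<beta> * (\<Prod>i\<in>UNIV. x $ i ^ \<beta> i) | c :: ('n \<Rightarrow> nat) \<Rightarrow> real. True}"

text \<open>The index set of the sum in \<open>poly_space\<close> is finite, so the sum does not degenerate to \<open>0\<close>.\<close>

lemma finite_exponents: "finite {\<beta> :: 'n::finite \<Rightarrow> nat. (\<Sum>i\<in>UNIV. \<beta> i) \<le> m}"
proof (rule finite_subset)
  show "{\<beta> :: 'n \<Rightarrow> nat. (\<Sum>i\<in>UNIV. \<beta> i) \<le> m} \<subseteq> UNIV \<rightarrow>\<^sub>E {..m}"
  proof (clarsimp simp: PiE_def)
    fix \<beta> :: "'n \<Rightarrow> nat" and i assume "(\<Sum>i\<in>UNIV. \<beta> i) \<le> m"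
    then show "\<beta> i \<le> m"
      using member_le_sum[of i UNIV \<beta>] by simp
  qed
qed (simp add: finite_PiE)

definition subsimplices :: "(real^'n) set \<Rightarrow> nat \<Rightarrow> (real^'n) set set" where
  "subsimplices T k = {F. F face_of T \<and> (int CARD('n) - int k) simplex F}"

definition tangent_space :: "(real^'n) set \<Rightarrow> (real^'n) set" where
  "tangent_space F = span {x - y | x y. x \<in> F \<and> y \<in> F}"

definition normal_frames :: "(real^'n) set \<Rightarrow> ((real^'n) set \<Rightarrow> nat \<Rightarrow> real^'n) \<Rightarrow> bool" where
  "normal_frames T \<nu> \<longleftrightarrow> (\<forall>k\<in>{1..CARD('n)}. \<forall>F\<in>subsimplices T k.
     inj_on (\<nu> F) {1..k} \<and> independent (\<nu> F ` {1..k}) \<and>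
     (\<forall>i\<in>{1..k}. norm (\<nu> F i) = 1 \<and> (\<forall>w\<in>tangent_space F. orthogonal (\<nu> F i) w)))"

text \<open>The \<open>d\<close>-dimensional Lebesgue measure on the affine hull of a \<open>d\<close>-dimensional convex set \<open>F\<close>,
  transported from orthonormal coordinates (cf. the definition of \<open>lborel\<close>). It does not depend on
  the chosen base point and orthonormal basis. For \<open>F = {x}\<close> the basis is empty and the
  measure is the unit point mass at \<open>x\<close>.\<close>

definition tangent_basis :: "(real^'n) set \<Rightarrow> (real^'n) set" where
  "tangent_basis F = (SOME B. pairwise orthogonal B \<and> (\<forall>b\<in>B. norm b = 1) \<and> span B = tangent_space F)"

definition face_measure :: "(real^'n) set \<Rightarrow> (real^'n) measure" where
  "face_measure F = distr (\<Pi>\<^sub>M b\<in>tangent_basis F. lborel) borel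
     (\<lambda>t. (SOME x. x \<in> F) + (\<Sum>b\<in>tangent_basis F. t b *\<^sub>R b))"

definition dir_deriv :: "real^'n \<Rightarrow> (real^'n \<Rightarrow> real) \<Rightarrow> real^'n \<Rightarrow> real" where
  "dir_deriv w v = (\<lambda>x. frechet_derivative v (at x) w)"

text \<open>Multi-indices are functions on \<open>nat\<close> vanishing outside \<open>{1..n}\<close>.\<close>

definition multi_indices :: "nat \<Rightarrow> (nat \<Rightarrow> nat) set" where
  "multi_indices n = {\<alpha>. \<forall>i. i \<notin> {1..n} \<longrightarrow> \<alpha> i = 0}"

definition A_set :: "nat \<Rightarrow> nat \<Rightarrow> (nat \<Rightarrow> nat) set" where
  "A_set n k = {\<alpha> \<in> multi_indices n. (\<Sum>i = k+1..n. \<alpha> i) = 0}"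

definition normal_deriv :: "(nat \<Rightarrow> real^'n) \<Rightarrow> nat \<Rightarrow> (nat \<Rightarrow> nat) \<Rightarrow> (real^'n \<Rightarrow> real) \<Rightarrow> real^'n \<Rightarrow> real" where
  "normal_deriv w k \<alpha> v = foldr (\<lambda>i. dir_deriv (w i) ^^ \<alpha> i) [1..<k+1] v"

text \<open>Here \<open>k\<close> is the codimension of \<open>F\<close>.\<close>

definition d_face ::
  "((real^'n) set \<Rightarrow> nat \<Rightarrow> real^'n) \<Rightarrow> nat \<Rightarrow> (real^'n) set \<Rightarrow> (nat \<Rightarrow> nat) \<Rightarrow> (real^'n \<Rightarrow> real) \<Rightarrow> real" where
  "d_face \<nu> k F \<alpha> v =
     1 / measure (face_measure F) F * (LINT x:F|face_measure F. normal_deriv (\<nu> F) k \<alpha> v x)"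

definition d_zero :: "(real^'n) set \<Rightarrow> (real^'n \<Rightarrow> real) \<Rightarrow> real" where
  "d_zero T v = 1 / measure lborel T * (LINT x:T|lborel. v x)"

text \<open>The levels \<open>l = -1, 0, \<dots>, L\<close> are integers, so that no subtraction below is truncated.\<close>

definition DOF_level ::
  "(real^'n) set \<Rightarrow> ((real^'n) set \<Rightarrow> nat \<Rightarrow> real^'n) \<Rightarrow> nat \<Rightarrow> int \<Rightarrow> ((real^'n \<Rightarrow> real) \<Rightarrow> real) set" where
  "DOF_level T \<nu> m l =
     (let n = CARD('n); L = int (m div (n+1)) in
      if l = -1 then (if m mod (n+1) = 0 then {d_zero T} else {})
      else {d_face \<nu> k F \<alpha> | k F \<alpha>.
              1 \<le> k \<and> int k \<le> min (int n) (int m - (int n + 1) * (L - l)) \<and>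
              F \<in> subsimplices T k \<and> \<alpha> \<in> A_set n k \<and>
              int (\<Sum>i = 1..n. \<alpha> i) = int m - int k - (int n + 1) * (L - l)})"

definition DOF ::
  "(real^'n) set \<Rightarrow> ((real^'n) set \<Rightarrow> nat \<Rightarrow> real^'n) \<Rightarrow> nat \<Rightarrow> ((real^'n \<Rightarrow> real) \<Rightarrow> real) set" where
  "DOF T \<nu> m = (\<Union>l\<in>{-1..int (m div (CARD('n) + 1))}. DOF_level T \<nu> m l)"

definition unisolvent :: "('a \<Rightarrow> real) set \<Rightarrow> (('a \<Rightarrow> real) \<Rightarrow> real) set \<Rightarrow> bool" where
  "unisolvent P D \<longleftrightarrow> bij_betw (\<lambda>v. \<lambda>d\<in>D. d v) P (D \<rightarrow>\<^sub>E UNIV)"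

end

theory Submission
  imports Defs
begin

text \<open>The functionals belonging to \<open>M = m - (n + 1) (L - l)\<close> are counted by Vandermonde's identity
  without its term of index \<open>n + 1\<close>, which is the dimension of the polynomials of degree at most
  \<open>M - (n + 1)\<close>. The sum over all levels therefore telescopes, and there are at most \<open>dim \<P>\<^sub>m\<close>
  functionals. It remains to show that a polynomial annihilated by all of them is \<open>0\<close>.

  The average over a simplex of the derivative along the edge from vertex \<open>a\<close> to vertex \<open>b\<close> is a
  multiple of the difference of the averages over the facets opposite to \<open>a\<close> and \<open>b\<close>. Together with
  the normal directions, the edges of a face span the whole space. Hence, by induction from the
  smallest faces upwards, all derivatives of order \<open>M - k\<close> have average \<open>0\<close> over all faces of
  codimension \<open>k \<le> M\<close>, including \<open>k = 0\<close> if \<open>M > 0\<close>. Now let \<open>j\<close> decrease from \<open>m\<close> to \<open>0\<close>: the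
  derivatives of order \<open>j\<close> of a polynomial of degree at most \<open>j\<close> are constant, hence \<open>0\<close>, and the
  degree drops.\<close>

section \<open>Translation invariant measures on subspaces\<close>

text \<open>An average does not see the normalisation of its measure, and this shapes the measure
  theory. \<open>face_measure\<close> rests on a base point and an orthonormal basis chosen by
  \<open>SOME\<close>, whereas the edge identity needs a basis of a face that extends a basis of a
  facet by an edge, and such a basis is oblique in general. Translation invariant measures on the
  same subspace agree up to a constant factor, which cancels in the average. So no determinants,
  heights or conormals are computed, and a formula for cones proved by Fubini takes the place of the
  divergence theorem on faces.

  The count is an upper bound only; coincidences between functionals are never excluded. Together
  with the trivial kernel it still yields surjectivity: a linear system with at most as many
  equations as unknowns and trivial kernel is solvable for every right-hand side.

  The parameter \<open>M = 0\<close> is exceptional: it admits no codimension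
  \<open>k \<ge> 1\<close>, and a derivative of order 0 contains no edge direction to integrate. The
  functional \<open>d_zero\<close> fills this gap.\<close>

definition span_measure :: "'a::euclidean_space set \<Rightarrow> 'a measure" where
  "span_measure B = distr (\<Pi>\<^sub>M b\<in>B. lborel) borel (\<lambda>t. \<Sum>b\<in>B. t b *\<^sub>R b)"

lemma sets_span_measure [simp, measurable_cong]: "sets (span_measure B) = sets borel"
  by (simp add: span_measure_def)

lemma space_span_measure [simp]: "space (span_measure B) = UNIV"
  by (simp add: span_measure_def)

lemma measurable_span_coords [measurable]:
  "(\<lambda>t. \<Sum>b\<in>B. t b *\<^sub>R b) \<in> measurable (\<Pi>\<^sub>M b\<in>B. lborel) (borel :: 'a::euclidean_space measure)"
  by measurable

interpretation lborel_product: product_sigma_finite "\<lambda>_. lborel :: real measure"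
  by standard

text \<open>The measure lives on the whole space but is invariant only under translations by vectors
  of \<open>span B\<close>. This fact lets a variable of integration serve as such a vector.\<close>

lemma AE_span_measure: "AE y in span_measure B. y \<in> span B"
proof -
  have "closed (span B)" by (simp add: closed_subspace)
  then have [measurable]: "span B \<in> sets borel" by (rule borel_closed)
  show ?thesis
    unfolding span_measure_def
    by (subst AE_distr_iff) (auto intro!: AE_I2 span_sum span_scale intro: span_base)
qed

text \<open>By independence each coordinate is a linear functional of the vector, hence bounded in
  finite dimension. A ball therefore has its coordinates in a box of finite measure.\<close>

lemma finite_span_measure_ball:
  fixes B :: "'a::euclidean_space set"
  assumes "independent B"
  shows "emeasure (span_measure B) (ball 0 r) < \<infinity>"
proof -
  have fin: "finite B" using assms by (rule independent_imp_finite)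
  have "\<exists>K. \<forall>t. \<bar>t b\<bar> \<le> K * norm (\<Sum>b\<in>B. t b *\<^sub>R b)" if "b \<in> B" for b
  proof -
    obtain f :: "'a \<Rightarrow> real" where f: "linear f" "\<And>x. x \<in> B \<Longrightarrow> f x = (if x = b then 1 else 0)"
      using linear_independent_extend[OF assms, of "\<lambda>x. if x = b then 1 else 0"] by auto
    have eq: "f (\<Sum>b\<in>B. t b *\<^sub>R b) = t b" for t
      using fin that by (simp add: linear_sum[OF f(1)] linear_scale[OF f(1)] f(2) if_distrib[of "(*) _"] cong: if_cong)
    have "bounded_linear f" using f(1) by (simp add: linear_conv_bounded_linear)
    then obtain K where "\<And>x. norm (f x) \<le> norm x * K" using bounded_linear.bounded by blast
    then show ?thesis using eq by (metis mult.commute real_norm_def)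
  qed
  then obtain K where K: "\<And>b t. b \<in> B \<Longrightarrow> \<bar>t b\<bar> \<le> K b * norm (\<Sum>b\<in>B. t b *\<^sub>R b)"
    by metis
  have "emeasure (span_measure B) (ball 0 r) =
      emeasure (\<Pi>\<^sub>M b\<in>B. lborel) ((\<lambda>t. \<Sum>b\<in>B. t b *\<^sub>R b) -` ball 0 r \<inter> space (\<Pi>\<^sub>M b\<in>B. lborel))"
    unfolding span_measure_def by (subst emeasure_distr) auto
  also have "\<dots> \<le> emeasure (\<Pi>\<^sub>M b\<in>B. lborel) (\<Pi>\<^sub>E b\<in>B. {- (\<bar>K b\<bar> * \<bar>r\<bar>) .. \<bar>K b\<bar> * \<bar>r\<bar>})"
  proof (rule emeasure_mono)
    show "(\<lambda>t. \<Sum>b\<in>B. t b *\<^sub>R b) -` ball 0 r \<inter> space (\<Pi>\<^sub>M b\<in>B. lborel)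
        \<subseteq> (\<Pi>\<^sub>E b\<in>B. {- (\<bar>K b\<bar> * \<bar>r\<bar>) .. \<bar>K b\<bar> * \<bar>r\<bar>})"
    proof
      fix t assume t: "t \<in> (\<lambda>t. \<Sum>b\<in>B. t b *\<^sub>R b) -` ball 0 r \<inter> space (\<Pi>\<^sub>M b\<in>B. lborel)"
      have "\<bar>t b\<bar> \<le> \<bar>K b\<bar> * \<bar>r\<bar>" if "b \<in> B" for b
      proof -
        have "\<bar>t b\<bar> \<le> K b * norm (\<Sum>b\<in>B. t b *\<^sub>R b)" by (rule K[OF that])
        also have "\<dots> \<le> \<bar>K b\<bar> * \<bar>r\<bar>" using t by (intro mult_mono) auto
        finally show ?thesis .
      qed
      then show "t \<in> (\<Pi>\<^sub>E b\<in>B. {- (\<bar>K b\<bar> * \<bar>r\<bar>) .. \<bar>K b\<bar> * \<bar>r\<bar>})"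
        using t by (force simp: space_PiM PiE_def abs_le_iff)
    qed
    show "(\<Pi>\<^sub>E b\<in>B. {- (\<bar>K b\<bar> * \<bar>r\<bar>) .. \<bar>K b\<bar> * \<bar>r\<bar>}) \<in> sets (\<Pi>\<^sub>M b\<in>B. lborel)"
      using fin by (intro sets_PiM_I_finite) auto
  qed
  also have "\<dots> = (\<Prod>b\<in>B. emeasure lborel {- (\<bar>K b\<bar> * \<bar>r\<bar>) .. \<bar>K b\<bar> * \<bar>r\<bar>})"
    using fin by (subst lborel_product.emeasure_PiM) auto
  also have "\<dots> < \<infinity>"
    by (simp add: ennreal_prod_eq_top less_top[symmetric])
  finally show ?thesis .
qed

lemma finite_span_measure_bounded:
  assumes "independent B" "bounded S"
  shows "emeasure (span_measure B) S < \<infinity>"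
proof -
  obtain r where "S \<subseteq> ball 0 r" using bounded_subset_ballD[OF assms(2)] by blast
  then have "emeasure (span_measure B) S \<le> emeasure (span_measure B) (ball 0 r)"
    by (rule emeasure_mono) simp
  then show ?thesis using finite_span_measure_ball[OF assms(1)] by (rule le_less_trans)
qed

lemma sigma_finite_span_measure:
  assumes "independent B"
  shows "sigma_finite_measure (span_measure B)"
proof
  show "\<exists>A. countable A \<and> A \<subseteq> sets (span_measure B) \<and> \<Union> A = space (span_measure B) \<and>
      (\<forall>a\<in>A. emeasure (span_measure B) a \<noteq> \<infinity>)"
  proof (intro exI[of _ "range (\<lambda>n. ball 0 (real n))"] conjI ballI)
    show "\<Union> (range (\<lambda>n. ball 0 (real n))) = space (span_measure B)"
      using reals_Archimedean2 by (auto simp: mem_ball)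
    fix a assume "a \<in> range (\<lambda>n. ball (0::'a) (real n))"
    then show "emeasure (span_measure B) a \<noteq> \<infinity>" using finite_span_measure_ball[OF assms] by (auto simp: less_top[symmetric] less_imp_neq)
  qed auto
qed

lemma span_measure_positive:
  fixes B :: "'a::euclidean_space set"
  assumes fin: "finite B"
  obtains R where "R > 0" "1 \<le> emeasure (span_measure B) (ball 0 R)"
proof
  \<comment> \<open>The vectors with coordinates in [0,1] form a set of measure at least 1 and have
    norm at most the sum of the norms; the summand 1 makes the radius positive and the bound
    strict.\<close>
  let ?R = "1 + (\<Sum>b\<in>B. norm b)"
  show "?R > 0" using sum_nonneg[of B norm] by (simp add: add_pos_nonneg)
  have "1 = (\<Prod>b\<in>B. emeasure lborel {0..1::real})" by simp
  also have "\<dots> = emeasure (\<Pi>\<^sub>M b\<in>B. lborel) (\<Pi>\<^sub>E b\<in>B. {0..1::real})"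
    using fin by (subst lborel_product.emeasure_PiM) auto
  also have "\<dots> \<le> emeasure (\<Pi>\<^sub>M b\<in>B. lborel) ((\<lambda>t. \<Sum>b\<in>B. t b *\<^sub>R b) -` ball 0 ?R \<inter> space (\<Pi>\<^sub>M b\<in>B. lborel))"
  proof (rule emeasure_mono)
    show "(\<Pi>\<^sub>E b\<in>B. {0..1}) \<subseteq> (\<lambda>t. \<Sum>b\<in>B. t b *\<^sub>R b) -` ball 0 ?R \<inter> space (\<Pi>\<^sub>M b\<in>B. lborel)"
    proof
      fix t :: "'a \<Rightarrow> real" assume t: "t \<in> (\<Pi>\<^sub>E b\<in>B. {0..1})"
      have "norm (\<Sum>b\<in>B. t b *\<^sub>R b) \<le> (\<Sum>b\<in>B. norm (t b *\<^sub>R b))" by (rule norm_sum)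
      also have "\<dots> \<le> (\<Sum>b\<in>B. norm b)"
        using t by (intro sum_mono) (auto simp: PiE_def Pi_def intro!: mult_left_le_one_le)
      finally show "t \<in> (\<lambda>t. \<Sum>b\<in>B. t b *\<^sub>R b) -` ball 0 ?R \<inter> space (\<Pi>\<^sub>M b\<in>B. lborel)"
        using t by (auto simp: space_PiM PiE_def)
    qed
  qed measurable
  also have "\<dots> = emeasure (span_measure B) (ball 0 ?R)"
    unfolding span_measure_def by (subst emeasure_distr) auto
  finally show "1 \<le> emeasure (span_measure B) (ball 0 ?R)" .
qed

lemma nn_integral_span_measure_insert:
  assumes "finite B" "e \<notin> B" and [measurable]: "f \<in> borel_measurable borel"
  shows "(\<integral>\<^sup>+x. f x \<partial>span_measure (insert e B)) = (\<integral>\<^sup>+s. (\<integral>\<^sup>+y. f (s *\<^sub>R e + y) \<partial>span_measure B) \<partial>lborel)"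
proof -
  have eq: "(\<Sum>b\<in>B. (t(e := s)) b *\<^sub>R b) = (\<Sum>b\<in>B. t b *\<^sub>R b)" for t s
    using assms(2) by (intro sum.cong) auto
  have "(\<integral>\<^sup>+x. f x \<partial>span_measure (insert e B)) =
    (\<integral>\<^sup>+t. f (\<Sum>b\<in>insert e B. t b *\<^sub>R b) \<partial>(\<Pi>\<^sub>M b\<in>insert e B. lborel))"
    unfolding span_measure_def by (subst nn_integral_distr) auto
  also have "\<dots> = (\<integral>\<^sup>+s. (\<integral>\<^sup>+t. f (\<Sum>b\<in>insert e B. (t(e:=s)) b *\<^sub>R b) \<partial>(\<Pi>\<^sub>M b\<in>B. lborel)) \<partial>lborel)"
    using assms by (subst lborel_product.product_nn_integral_insert_rev) auto
  also have "\<dots> = (\<integral>\<^sup>+s. (\<integral>\<^sup>+t. f (s *\<^sub>R e + (\<Sum>b\<in>B. t b *\<^sub>R b)) \<partial>(\<Pi>\<^sub>M b\<in>B. lborel)) \<partial>lborel)"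
    using assms by (simp only: sum.insert[OF assms(1,2)] eq fun_upd_same)
  also have "\<dots> = (\<integral>\<^sup>+s. (\<integral>\<^sup>+y. f (s *\<^sub>R e + y) \<partial>span_measure B) \<partial>lborel)"
    unfolding span_measure_def by (subst nn_integral_distr) auto
  finally show ?thesis .
qed

text \<open>Induction over the basis: the component of \<open>w\<close> along the new vector
  \<open>e\<close> is absorbed by a shift of the coordinate \<open>s\<close>, and the remainder is a
  translation within \<open>span B\<close>.\<close>

lemma nn_integral_span_measure_translate:
  assumes "independent B" "w \<in> span B" and "f \<in> borel_measurable borel"
  shows "(\<integral>\<^sup>+y. f (y + w) \<partial>span_measure B) = (\<integral>\<^sup>+y. f y \<partial>span_measure B)"
proof -
  have "finite B" using assms(1) by (rule independent_imp_finite)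
  then show ?thesis using assms
  proof (induction B arbitrary: w f rule: finite_induct)
    case empty
    then show ?case by simp
  next
    case (insert e B)
    note [measurable] = insert.prems(3)
    have indep: "independent B" using insert.prems(1) by (rule independent_mono) auto
    interpret sigma_finite_measure "span_measure B" by (rule sigma_finite_span_measure[OF indep])
    obtain k where k: "w - k *\<^sub>R e \<in> span B" using insert.prems(2) by (auto simp: span_insert)
    have "(\<integral>\<^sup>+y. f (y + w) \<partial>span_measure (insert e B)) =
        (\<integral>\<^sup>+s. (\<integral>\<^sup>+y. f ((s *\<^sub>R e + y) + w) \<partial>span_measure B) \<partial>lborel)"
      using insert.hyps by (subst nn_integral_span_measure_insert) auto
    \<comment> \<open>The factor 1 gives the argument the affine form of
      \<open>nn_integral_real_affine\<close>.\<close>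
    also have "\<dots> = (\<integral>\<^sup>+s. (\<integral>\<^sup>+y. f ((k + 1 * s) *\<^sub>R e + (y + (w - k *\<^sub>R e))) \<partial>span_measure B) \<partial>lborel)"
      by (simp add: algebra_simps)
    also have "\<dots> = (\<integral>\<^sup>+s. (\<integral>\<^sup>+y. f ((k + 1 * s) *\<^sub>R e + y) \<partial>span_measure B) \<partial>lborel)"
      by (intro nn_integral_cong insert.IH[OF indep k, of "\<lambda>y. f (_ *\<^sub>R e + y)"]) measurable
    also have "\<dots> = (\<integral>\<^sup>+s. (\<integral>\<^sup>+y. f (s *\<^sub>R e + y) \<partial>span_measure B) \<partial>lborel)"
      by (subst (2) nn_integral_real_affine[where c=1 and t=k]) auto
    also have "\<dots> = (\<integral>\<^sup>+y. f y \<partial>span_measure (insert e B))"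
      using insert.hyps by (subst nn_integral_span_measure_insert) auto
    finally show ?case .
  qed
qed

lemma nn_integral_span_measure_scale:
  assumes "independent B" "r > 0" and "f \<in> borel_measurable borel"
  shows "(\<integral>\<^sup>+y. f y \<partial>span_measure B) = ennreal (r ^ card B) * (\<integral>\<^sup>+y. f (r *\<^sub>R y) \<partial>span_measure B)"
proof -
  have "finite B" using assms(1) by (rule independent_imp_finite)
  then show ?thesis using assms
  proof (induction B arbitrary: f rule: finite_induct)
    case empty
    \<comment> \<open>The product measure over the empty index set is the point mass at this
      function.\<close>
    have "(\<lambda>t\<in>{}. undefined) = (\<lambda>_. undefined)" by auto
    then show ?case using empty unfolding span_measure_def
      by (simp add: nn_integral_distr PiM_empty nn_integral_count_space_finite)
  next
    case (insert e B)
    note [measurable] = insert.prems(3)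
    have indep: "independent B" using insert.prems(1) by (rule independent_mono) auto
    interpret sigma_finite_measure "span_measure B" by (rule sigma_finite_span_measure[OF indep])
    have "(\<integral>\<^sup>+y. f y \<partial>span_measure (insert e B)) =
        (\<integral>\<^sup>+s. (\<integral>\<^sup>+y. f (s *\<^sub>R e + y) \<partial>span_measure B) \<partial>lborel)"
      using insert.hyps by (subst nn_integral_span_measure_insert) auto
    also have "\<dots> = (\<integral>\<^sup>+s. ennreal (r ^ card B) * (\<integral>\<^sup>+y. f (s *\<^sub>R e + r *\<^sub>R y) \<partial>span_measure B) \<partial>lborel)"
      by (intro nn_integral_cong insert.IH[OF indep insert.prems(2), of "\<lambda>y. f (_ *\<^sub>R e + y)"]) measurable
    also have "\<dots> = \<bar>r\<bar> * (\<integral>\<^sup>+s. ennreal (r ^ card B) * (\<integral>\<^sup>+y. f ((0 + r * s) *\<^sub>R e + r *\<^sub>R y) \<partial>span_measure B) \<partial>lborel)"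
      using insert.prems(2) by (subst nn_integral_real_affine[where c=r and t=0]) auto
    also have "\<dots> = ennreal (r ^ card (insert e B)) * (\<integral>\<^sup>+s. (\<integral>\<^sup>+y. f (r *\<^sub>R (s *\<^sub>R e + y)) \<partial>span_measure B) \<partial>lborel)"
      using insert.hyps insert.prems(2)
      by (subst nn_integral_cmult) (auto simp: ennreal_mult algebra_simps)
    also have "\<dots> = ennreal (r ^ card (insert e B)) * (\<integral>\<^sup>+y. f (r *\<^sub>R y) \<partial>span_measure (insert e B))"
      using insert.hyps by (subst nn_integral_span_measure_insert) auto
    finally show ?case .
  qed
qed

text \<open>Uniqueness of Haar measure: for translation invariant measures \<open>\<mu>\<close> and \<open>\<lambda>\<close>, Tonelli's theorem gives
  \<open>\<integral>\<integral> f x * g y = \<integral>\<integral> f x * g (y - x) = \<integral>\<integral> f (x + y) * g (- x) = (\<integral> f) * (\<integral> g (- x))\<close>, where the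
  variables \<open>x\<close> and \<open>y\<close> are integrated with respect to \<open>\<mu>\<close> and \<open>\<lambda>\<close>, but \<open>f\<close> ends up integrated with respect
  to \<open>\<lambda>\<close>.\<close>

lemma nn_integral_span_measure_swap:
  assumes B: "independent B" and C: "independent C" and sp: "span B = span C"
    and [measurable]: "f \<in> borel_measurable borel" "g \<in> borel_measurable borel"
  shows "(\<integral>\<^sup>+x. f x \<partial>span_measure B) * (\<integral>\<^sup>+y. g y \<partial>span_measure C) =
    (\<integral>\<^sup>+x. f x \<partial>span_measure C) * (\<integral>\<^sup>+y. g (- y) \<partial>span_measure B)"
proof -
  interpret B: sigma_finite_measure "span_measure B" by (rule sigma_finite_span_measure[OF B])
  interpret C: sigma_finite_measure "span_measure C" by (rule sigma_finite_span_measure[OF C])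
  interpret P: pair_sigma_finite "span_measure B" "span_measure C" ..
  have "(\<integral>\<^sup>+x. f x \<partial>span_measure B) * (\<integral>\<^sup>+y. g y \<partial>span_measure C) =
      (\<integral>\<^sup>+x. f x * (\<integral>\<^sup>+y. g y \<partial>span_measure C) \<partial>span_measure B)"
    by (simp add: nn_integral_multc)
  also have "\<dots> = (\<integral>\<^sup>+x. f x * (\<integral>\<^sup>+y. g (y - x) \<partial>span_measure C) \<partial>span_measure B)"
  proof (rule nn_integral_cong_AE, use AE_span_measure[of B] in eventually_elim)
    case (elim x)
    then have "- x \<in> span C" using sp by (simp add: span_neg)
    from nn_integral_span_measure_translate[OF C this, of g]
    show ?case by simp
  qed
  also have "\<dots> = (\<integral>\<^sup>+x. (\<integral>\<^sup>+y. f x * g (y - x) \<partial>span_measure C) \<partial>span_measure B)"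
    by (subst nn_integral_cmult) auto
  also have "\<dots> = (\<integral>\<^sup>+y. (\<integral>\<^sup>+x. f x * g (y - x) \<partial>span_measure B) \<partial>span_measure C)"
    by (rule P.Fubini'[symmetric]) measurable
  also have "\<dots> = (\<integral>\<^sup>+y. (\<integral>\<^sup>+x. f (x + y) * g (- x) \<partial>span_measure B) \<partial>span_measure C)"
  proof (rule nn_integral_cong_AE, use AE_span_measure[of C] in eventually_elim)
    case (elim y)
    then have "y \<in> span B" using sp by simp
    from nn_integral_span_measure_translate[OF B this, of "\<lambda>x. f x * g (y - x)"]
    show ?case by simp
  qed
  also have "\<dots> = (\<integral>\<^sup>+x. (\<integral>\<^sup>+y. f (x + y) * g (- x) \<partial>span_measure C) \<partial>span_measure B)"
    by (rule P.Fubini') measurable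
  also have "\<dots> = (\<integral>\<^sup>+x. (\<integral>\<^sup>+y. f (x + y) \<partial>span_measure C) * g (- x) \<partial>span_measure B)"
    by (subst nn_integral_multc) auto
  also have "\<dots> = (\<integral>\<^sup>+x. (\<integral>\<^sup>+y. f y \<partial>span_measure C) * g (- x) \<partial>span_measure B)"
  proof (rule nn_integral_cong_AE, use AE_span_measure[of B] in eventually_elim)
    case (elim x)
    then have "x \<in> span C" using sp by simp
    from nn_integral_span_measure_translate[OF C this, of f]
    show ?case by (simp add: add.commute)
  qed
  also have "\<dots> = (\<integral>\<^sup>+x. f x \<partial>span_measure C) * (\<integral>\<^sup>+y. g (- y) \<partial>span_measure B)"
    by (subst nn_integral_cmult) auto
  finally show ?thesis .
qed

text \<open>In the swap identity take for \<open>g\<close> the indicator of a ball \<open>Q\<close>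
  around 0. Its symmetry removes the reflection, and its radius is large enough for positive measure
  on both sides. The constant is the ratio of the two measures of \<open>Q\<close>.\<close>

lemma span_measure_unique:
  fixes B C :: "'a::euclidean_space set"
  assumes B: "independent B" and C: "independent C" and sp: "span B = span C"
  obtains c :: real where "c > 0" "span_measure B = density (span_measure C) (\<lambda>_. ennreal c)"
proof -
  obtain R where R: "R > 0" "1 \<le> emeasure (span_measure C) (ball 0 R)"
    using span_measure_positive[OF independent_imp_finite[OF C]] by blast
  obtain R' where R': "R' > 0" "1 \<le> emeasure (span_measure B) (ball 0 R')"
    using span_measure_positive[OF independent_imp_finite[OF B]] by blast
  define Q :: "'a set" where "Q = ball 0 (max R R')"
  have sym: "(\<integral>\<^sup>+y. indicator Q (- y) \<partial>M) = (\<integral>\<^sup>+y. indicator Q y \<partial>M)" for M :: "'a measure"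
    by (intro nn_integral_cong) (auto simp: Q_def indicator_def)
  have Q[measurable]: "Q \<in> sets borel" by (simp add: Q_def)
  have "emeasure (span_measure C) (ball 0 R) \<le> emeasure (span_measure C) Q"
    by (rule emeasure_mono) (auto simp: Q_def)
  then have C1: "emeasure (span_measure C) Q \<ge> 1" using R(2) by (rule order_trans[rotated])
  have "emeasure (span_measure B) (ball 0 R') \<le> emeasure (span_measure B) Q"
    by (rule emeasure_mono) (auto simp: Q_def)
  then have B1: "emeasure (span_measure B) Q \<ge> 1" using R'(2) by (rule order_trans[rotated])
  have Cfin: "emeasure (span_measure C) Q < \<infinity>" and Bfin: "emeasure (span_measure B) Q < \<infinity>"
    unfolding Q_def by (intro finite_span_measure_ball B C)+
  define bq where "bq = enn2real (emeasure (span_measure B) Q)"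
  define cq where "cq = enn2real (emeasure (span_measure C) Q)"
  have bq: "emeasure (span_measure B) Q = ennreal bq" and cq: "emeasure (span_measure C) Q = ennreal cq"
    using Bfin Cfin by (auto simp: bq_def cq_def)
  have pos: "bq > 0" "cq > 0"
    using B1 C1 unfolding bq cq by (metis ennreal_neg not_le not_one_le_zero)+
  show thesis
  proof
    show "bq / cq > 0" using pos by simp
    show "span_measure B = density (span_measure C) (\<lambda>_. ennreal (bq / cq))"
    proof (rule measure_eqI)
      fix A assume "A \<in> sets (span_measure B)"
      then have [measurable]: "A \<in> sets borel" by simp
      have "emeasure (span_measure B) A * ennreal cq = emeasure (span_measure C) A * ennreal bq"
        using nn_integral_span_measure_swap[OF B C sp, of "indicator A" "indicator Q"]
        by (simp add: sym bq[symmetric] cq[symmetric])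
      then have "emeasure (span_measure B) A * ennreal cq * ennreal (1 / cq) =
          emeasure (span_measure C) A * ennreal bq * ennreal (1 / cq)" by simp
      then have "emeasure (span_measure B) A = ennreal (bq / cq) * emeasure (span_measure C) A"
        using pos by (simp add: mult.assoc ennreal_mult[symmetric]) (simp add: mult.commute)
      then show "emeasure (span_measure B) A = emeasure (density (span_measure C) (\<lambda>_. ennreal (bq / cq))) A"
        by (simp add: emeasure_density nn_integral_cmult)
    qed simp
  qed
qed

section \<open>Integration over cones\<close>

lemma span_measure_translate:
  assumes "independent B" "w \<in> span B"
  shows "distr (span_measure B) borel (\<lambda>y. y + w) = span_measure B"
proof (rule measure_eqI)
  fix A assume "A \<in> sets (distr (span_measure B) borel (\<lambda>y. y + w))"
  then have [measurable]: "A \<in> sets borel" by simp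
  have "emeasure (distr (span_measure B) borel (\<lambda>y. y + w)) A = (\<integral>\<^sup>+y. indicator A y \<partial>distr (span_measure B) borel (\<lambda>y. y + w))"
    by simp
  also have "\<dots> = (\<integral>\<^sup>+y. indicator A (y + w) \<partial>span_measure B)"
    by (subst nn_integral_distr) auto
  also have "\<dots> = emeasure (span_measure B) A"
    using nn_integral_span_measure_translate[OF assms, of "indicator A"] by simp
  finally show "emeasure (distr (span_measure B) borel (\<lambda>y. y + w)) A = emeasure (span_measure B) A" .
qed simp

lemma integral_span_measure_translate:
  fixes f :: "'a::euclidean_space \<Rightarrow> real"
  assumes "independent B" "w \<in> span B" and [measurable]: "f \<in> borel_measurable borel"
  shows "(LINT y|span_measure B. f (y + w)) = (LINT y|span_measure B. f y)"
proof -
  have "(LINT y|span_measure B. f y) = (LINT y|distr (span_measure B) borel (\<lambda>y. y + w). f y)"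
    by (simp add: span_measure_translate[OF assms(1,2)])
  also have "\<dots> = (LINT y|span_measure B. f (y + w))" by (rule integral_distr) measurable
  finally show ?thesis by simp
qed

lemma span_measure_scale:
  assumes "independent B" "r > 0"
  shows "density (distr (span_measure B) borel (\<lambda>y. r *\<^sub>R y)) (\<lambda>_. ennreal (r ^ card B)) = span_measure B"
proof (rule measure_eqI)
  fix A assume "A \<in> sets (density (distr (span_measure B) borel (\<lambda>y. r *\<^sub>R y)) (\<lambda>_. ennreal (r ^ card B)))"
  then have [measurable]: "A \<in> sets borel" by simp
  have "emeasure (density (distr (span_measure B) borel (\<lambda>y. r *\<^sub>R y)) (\<lambda>_. ennreal (r ^ card B))) A =
      ennreal (r ^ card B) * (\<integral>\<^sup>+y. indicator A y \<partial>distr (span_measure B) borel (\<lambda>y. r *\<^sub>R y))"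
    by (simp add: emeasure_density nn_integral_cmult)
  also have "\<dots> = ennreal (r ^ card B) * (\<integral>\<^sup>+y. indicator A (r *\<^sub>R y) \<partial>span_measure B)"
    by (subst nn_integral_distr) auto
  also have "\<dots> = emeasure (span_measure B) A"
    using nn_integral_span_measure_scale[OF assms, of "indicator A"] by simp
  finally show "emeasure (density (distr (span_measure B) borel (\<lambda>y. r *\<^sub>R y)) (\<lambda>_. ennreal (r ^ card B))) A
    = emeasure (span_measure B) A" .
qed simp

lemma integral_span_measure_scale:
  fixes f :: "'a::euclidean_space \<Rightarrow> real"
  assumes "independent B" "r > 0" and [measurable]: "f \<in> borel_measurable borel"
  shows "(LINT y|span_measure B. f y) = r ^ card B * (LINT y|span_measure B. f (r *\<^sub>R y))"
proof -
  have "(LINT y|span_measure B. f y) =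
      (LINT y|density (distr (span_measure B) borel (\<lambda>y. r *\<^sub>R y)) (\<lambda>_. ennreal (r ^ card B)). f y)"
    by (simp add: span_measure_scale[OF assms(1,2)])
  also have "\<dots> = (LINT y|distr (span_measure B) borel (\<lambda>y. r *\<^sub>R y). r ^ card B *\<^sub>R f y)"
    using assms(2) by (intro integral_density) auto
  also have "\<dots> = (LINT y|span_measure B. r ^ card B *\<^sub>R f (r *\<^sub>R y))"
    by (rule integral_distr) measurable
  finally show ?thesis by simp
qed

text \<open>Any ball around 0 is a dilation of the large ball known to have positive measure, and a
  dilation changes the measure by a finite factor.\<close>

lemma span_measure_ball_pos:
  fixes B :: "'a::euclidean_space set"
  assumes "independent B" "r > 0"
  shows "emeasure (span_measure B) (ball 0 r) > 0"
proof -
  obtain R where R: "R > 0" "1 \<le> emeasure (span_measure B) (ball 0 R)"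
    using span_measure_positive[OF independent_imp_finite[OF assms(1)]] by blast
  have ind: "indicator (ball 0 R) ((R / r) *\<^sub>R y) = (indicator (ball 0 r) y :: ennreal)" for y :: 'a
  proof -
    have "norm ((R / r) *\<^sub>R y) < R \<longleftrightarrow> norm y < r"
      using R(1) assms(2) by (simp add: field_simps)
    then show ?thesis by (simp add: indicator_def)
  qed
  have "emeasure (span_measure B) (ball 0 R) = ennreal ((R / r) ^ card B) * emeasure (span_measure B) (ball 0 r)"
    using nn_integral_span_measure_scale[OF assms(1), of "R / r" "indicator (ball 0 R)"] R(1) assms(2)
    by (simp add: ind borel_measurable_indicator)
  then have "emeasure (span_measure B) (ball 0 r) \<noteq> 0" using R(2) by auto
  then show ?thesis by (simp add: zero_less_iff_neq_zero)
qed

text \<open>Splitting off one coordinate as an equality of measures, so that it also serves for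
  integrals of signed functions.\<close>

lemma span_measure_insert_eq_distr:
  assumes "independent B" "e \<notin> B"
  shows "span_measure (insert e B) =
    distr (lborel \<Otimes>\<^sub>M span_measure B) borel (\<lambda>(s, y). s *\<^sub>R e + y)"
proof (rule measure_eqI)
  interpret sigma_finite_measure "span_measure B" by (rule sigma_finite_span_measure[OF assms(1)])
  fix A assume "A \<in> sets (span_measure (insert e B))"
  then have [measurable]: "A \<in> sets borel" by simp
  have "emeasure (span_measure (insert e B)) A = (\<integral>\<^sup>+x. indicator A x \<partial>span_measure (insert e B))" by simp
  also have "\<dots> = (\<integral>\<^sup>+s. (\<integral>\<^sup>+y. indicator A (s *\<^sub>R e + y) \<partial>span_measure B) \<partial>lborel)"
    using assms independent_imp_finite[OF assms(1)] by (subst nn_integral_span_measure_insert) auto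
  also have "\<dots> = (\<integral>\<^sup>+z. indicator A (case z of (s, y) \<Rightarrow> s *\<^sub>R e + y) \<partial>(lborel \<Otimes>\<^sub>M span_measure B))"
    by (subst nn_integral_fst[symmetric]) auto
  also have "\<dots> = (\<integral>\<^sup>+x. indicator A x \<partial>distr (lborel \<Otimes>\<^sub>M span_measure B) borel (\<lambda>(s, y). s *\<^sub>R e + y))"
    by (subst nn_integral_distr) auto
  also have "\<dots> = emeasure (distr (lborel \<Otimes>\<^sub>M span_measure B) borel (\<lambda>(s, y). s *\<^sub>R e + y)) A"
    by simp
  finally show "emeasure (span_measure (insert e B)) A = emeasure (distr (lborel \<Otimes>\<^sub>M span_measure B) borel (\<lambda>(s, y). s *\<^sub>R e + y)) A" .
qed simp

lemma integrable_span_measure_compact: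
  fixes f :: "'a::euclidean_space \<Rightarrow> real"
  assumes "independent B" "compact S" "continuous_on UNIV f"
  shows "integrable (span_measure B) (\<lambda>x. indicator S x * f x)"
proof -
  have "bounded (f ` S)"
    by (intro compact_imp_bounded compact_continuous_image continuous_on_subset[OF assms(3)] assms(2)) simp
  then obtain K where "\<And>x. x \<in> S \<Longrightarrow> norm (f x) \<le> K"
    by (auto simp: bounded_iff)
  moreover have [measurable]: "f \<in> borel_measurable borel" using assms(3) by (rule borel_measurable_continuous_onI)
  ultimately have "integrable (span_measure B) (\<lambda>x. indicator S x *\<^sub>R f x)"
    using finite_span_measure_bounded[OF assms(1) compact_imp_bounded[OF assms(2)]] assms(2)
    by (intro integrableI_bounded_set_indicator[where B=K]) (auto intro: borel_compact)
  then show ?thesis by simp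
qed

text \<open>\<open>S\<close> is the cone with apex 0 over \<open>e + K\<close>. Its slice at height
  \<open>s\<close> is \<open>e + K\<close> dilated by \<open>s\<close>, so rescaling the slice
  produces \<open>s ^ card B\<close>; Fubini then leaves an inner integral along the ray through
  \<open>e + w\<close>.\<close>

lemma cone_integral:
  fixes e :: "'a::euclidean_space" and g :: "'a \<Rightarrow> real"
  assumes B: "independent B" and e: "e \<notin> span B" and K: "compact K" "K \<subseteq> span B"
    and g: "continuous_on UNIV g"
    and S: "S = (\<lambda>(s, w). s *\<^sub>R (e + w)) ` ({0..1} \<times> K)"
  shows "(LINT x|span_measure (insert e B). indicator S x * g x) =
    (LINT w|span_measure B. indicator K w * (LINT s|lborel. indicator {0..1} s * (s ^ card B * g (s *\<^sub>R (e + w)))))"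
proof -
  interpret M: sigma_finite_measure "span_measure B" by (rule sigma_finite_span_measure[OF B])
  interpret P: pair_sigma_finite lborel "span_measure B" ..
  have eB: "e \<notin> B" using e span_base by blast
  have indep: "independent (insert e B)" using B e by (simp add: independent_insertI)
  have "compact S" unfolding S
    by (intro compact_continuous_image compact_Times K) (auto simp: case_prod_unfold intro!: continuous_intros)
  then have [measurable]: "S \<in> sets borel" by (rule borel_compact)
  have [measurable]: "K \<in> sets borel" using K(1) by (rule borel_compact)
  have [measurable]: "g \<in> borel_measurable borel" using g by (rule borel_measurable_continuous_onI)
  \<comment> \<open>The height is determined by the point because \<open>e\<close> lies outside
    \<open>span B\<close>.\<close>
  have S_iff: "s *\<^sub>R e + y \<in> S \<longleftrightarrow> s \<in> {0..1} \<and> (\<exists>w\<in>K. y = s *\<^sub>R w)" if y: "y \<in> span B" for s y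
  proof
    assume "s *\<^sub>R e + y \<in> S"
    then obtain s' w where sw: "s' \<in> {0..1}" "w \<in> K" "s *\<^sub>R e + y = s' *\<^sub>R (e + w)" unfolding S by auto
    then have eq: "(s - s') *\<^sub>R e = s' *\<^sub>R w - y" by (simp add: algebra_simps)
    moreover have "s' *\<^sub>R w - y \<in> span B" using sw(2) K(2) y by (intro span_diff span_scale) auto
    ultimately have "(s - s') *\<^sub>R e \<in> span B" by simp
    then have "s = s'" using e span_scale[of "(s - s') *\<^sub>R e" B "1 / (s - s')"] by (cases "s = s'") auto
    then show "s \<in> {0..1} \<and> (\<exists>w\<in>K. y = s *\<^sub>R w)" using sw eq by auto
  next
    assume "s \<in> {0..1} \<and> (\<exists>w\<in>K. y = s *\<^sub>R w)"
    then show "s *\<^sub>R e + y \<in> S" unfolding S by (force simp: scaleR_add_right)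
  qed
  have eq: "span_measure (insert e B) = distr (lborel \<Otimes>\<^sub>M span_measure B) borel (\<lambda>(s, y). s *\<^sub>R e + y)"
    by (rule span_measure_insert_eq_distr[OF B eB])
  have int1: "integrable (lborel \<Otimes>\<^sub>M span_measure B) (\<lambda>(s, y). indicator S (s *\<^sub>R e + y) * g (s *\<^sub>R e + y))"
  proof -
    have "integrable (distr (lborel \<Otimes>\<^sub>M span_measure B) borel (\<lambda>(s, y). s *\<^sub>R e + y)) (\<lambda>x. indicator S x * g x)"
      using integrable_span_measure_compact[OF indep \<open>compact S\<close> g] by (simp add: eq)
    then show ?thesis by (subst (asm) integrable_distr_eq) (auto simp: case_prod_unfold)
  qed
  have "bounded ((\<lambda>(s, w). s ^ card B * g (s *\<^sub>R (e + w))) ` ({0..1} \<times> K))"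
    by (intro compact_imp_bounded compact_continuous_image compact_Times K)
       (auto simp: case_prod_unfold intro!: continuous_intros continuous_on_compose2[OF g])
  then obtain C where C: "\<And>s w. s \<in> {0..1} \<Longrightarrow> w \<in> K \<Longrightarrow> \<bar>s ^ card B * g (s *\<^sub>R (e + w))\<bar> \<le> C"
    unfolding bounded_iff by force
  have fin: "emeasure (lborel \<Otimes>\<^sub>M span_measure B) ({0..1::real} \<times> K) < \<infinity>"
    using finite_span_measure_bounded[OF B compact_imp_bounded[OF K(1)]]
    by (subst M.emeasure_pair_measure_Times) (auto simp: ennreal_mult_less_top)
  have int2: "integrable (lborel \<Otimes>\<^sub>M span_measure B)
     (\<lambda>(s, w). indicator {0..1} s * (indicator K w * (s ^ card B * g (s *\<^sub>R (e + w)))))"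
  proof -
    have "integrable (lborel \<Otimes>\<^sub>M span_measure B)
      (\<lambda>z. indicator ({0..1} \<times> K) z *\<^sub>R (case z of (s, w) \<Rightarrow> s ^ card B * g (s *\<^sub>R (e + w))))"
    proof (rule integrableI_bounded_set_indicator[OF _ _ fin])
      show "AE z in lborel \<Otimes>\<^sub>M span_measure B. z \<in> {0..1} \<times> K \<longrightarrow>
          norm (case z of (s, w) \<Rightarrow> s ^ card B * g (s *\<^sub>R (e + w))) \<le> C"
        using C by (intro AE_I2) auto
    qed measurable
    also have "(\<lambda>z. indicator ({0..1} \<times> K) z *\<^sub>R (case z of (s, w) \<Rightarrow> s ^ card B * g (s *\<^sub>R (e + w)))) =
        (\<lambda>(s, w). indicator {0..1} s * (indicator K w * (s ^ card B * g (s *\<^sub>R (e + w)))))"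
      by (auto simp: fun_eq_iff indicator_def)
    finally show ?thesis .
  qed
  have "(LINT x|span_measure (insert e B). indicator S x * g x) =
      (LINT z|(lborel \<Otimes>\<^sub>M span_measure B). (case z of (s, y) \<Rightarrow> indicator S (s *\<^sub>R e + y) * g (s *\<^sub>R e + y)))"
    unfolding eq by (subst integral_distr) (auto simp: case_prod_unfold)
  also have "\<dots> = (LINT s|lborel. LINT y|span_measure B. indicator S (s *\<^sub>R e + y) * g (s *\<^sub>R e + y))"
    by (rule P.integral_fst[OF int1, symmetric])
  also have "\<dots> = (LINT s|lborel. LINT w|span_measure B. indicator {0..1} s * (indicator K w * (s ^ card B * g (s *\<^sub>R (e + w)))))"
  proof (rule integral_cong_AE)
    \<comment> \<open>At height 0 the dilation degenerates and cannot be undone; this single height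
      is a null set.\<close>
    show "AE s in lborel. (LINT y|span_measure B. indicator S (s *\<^sub>R e + y) * g (s *\<^sub>R e + y)) =
        (LINT w|span_measure B. indicator {0..1} s * (indicator K w * (s ^ card B * g (s *\<^sub>R (e + w)))))"
      using AE_lborel_singleton[of 0]
    proof eventually_elim
      case (elim s)
      show ?case
      proof (cases "s \<in> {0..1}")
        case False
        have "AE y in span_measure B. indicator S (s *\<^sub>R e + y) * g (s *\<^sub>R e + y) = 0"
          using AE_span_measure by eventually_elim (use False in \<open>auto simp: S_iff indicator_def\<close>)
        then have "(LINT y|span_measure B. indicator S (s *\<^sub>R e + y) * g (s *\<^sub>R e + y)) = 0"
          by (rule integral_eq_zero_AE)
        with False show ?thesis by simp
      next
        case True
        then have s: "s > 0" using elim by simp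
        have "(LINT y|span_measure B. indicator S (s *\<^sub>R e + y) * g (s *\<^sub>R e + y)) =
          s ^ card B * (LINT w|span_measure B. indicator S (s *\<^sub>R e + s *\<^sub>R w) * g (s *\<^sub>R e + s *\<^sub>R w))"
          by (rule integral_span_measure_scale[OF B s]) measurable
        also have "(LINT w|span_measure B. indicator S (s *\<^sub>R e + s *\<^sub>R w) * g (s *\<^sub>R e + s *\<^sub>R w)) =
          (LINT w|span_measure B. indicator K w * g (s *\<^sub>R (e + w)))"
        proof (rule integral_cong_AE)
          show "AE w in span_measure B. indicator S (s *\<^sub>R e + s *\<^sub>R w) * g (s *\<^sub>R e + s *\<^sub>R w) = indicator K w * g (s *\<^sub>R (e + w))"
            using AE_span_measure
          proof eventually_elim
            case (elim w)
            have "s *\<^sub>R e + s *\<^sub>R w \<in> S \<longleftrightarrow> w \<in> K"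
              using elim True s by (subst S_iff) (auto simp: span_scale)
            then show ?case by (simp add: indicator_def scaleR_add_right)
          qed
        qed measurable
        finally have "(LINT y|span_measure B. indicator S (s *\<^sub>R e + y) * g (s *\<^sub>R e + y)) =
            s ^ card B * (LINT w|span_measure B. indicator K w * g (s *\<^sub>R (e + w)))" .
        then show ?thesis using True
          by (simp add: mult.left_commute[of _ "s ^ card B"])
      qed
    qed
  qed measurable
  also have "\<dots> = (LINT w|span_measure B. LINT s|lborel. indicator {0..1} s * (indicator K w * (s ^ card B * g (s *\<^sub>R (e + w)))))"
    by (rule trans[OF P.integral_fst[OF int2] P.integral_snd[OF int2, symmetric]])
  also have "\<dots> = (LINT w|span_measure B. indicator K w * (LINT s|lborel. indicator {0..1} s * (s ^ card B * g (s *\<^sub>R (e + w)))))"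
    by (simp only: mult.left_commute[of "indicator {0..1} _"] integral_mult_right_zero)
  finally show ?thesis .
qed

text \<open>Along the ray through \<open>z = e + w\<close> the integrand times
  \<open>s ^ card B\<close> is the derivative of
  \<open>s ^ (card B + 1) * u (s *\<^sub>R z)\<close>. This function vanishes at the apex, so only
  the value on the base of the cone survives.\<close>

lemma cone_integral_Euler:
  fixes e :: "'a::euclidean_space" and u :: "'a \<Rightarrow> real"
  assumes B: "independent B" and e: "e \<notin> span B" and K: "compact K" "K \<subseteq> span B"
    and u: "\<And>x. (u has_derivative u' x) (at x)" and u': "continuous_on UNIV (\<lambda>x. u' x x)"
    and S: "S = (\<lambda>(s, w). s *\<^sub>R (e + w)) ` ({0..1} \<times> K)"
  shows "(LINT x|span_measure (insert e B). indicator S x * (u' x x + real (card B + 1) * u x)) =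
    (LINT w|span_measure B. indicator K w * u (e + w))"
proof -
  have cu: "continuous_on UNIV u"
    using u by (meson continuous_at_imp_continuous_on has_derivative_continuous)
  have inner: "(LINT s|lborel. indicator {0..1} s * (s ^ card B *
      (u' (s *\<^sub>R z) (s *\<^sub>R z) + real (card B + 1) * u (s *\<^sub>R z)))) = u z" for z
  proof -
    have "(LINT s|lborel. indicator {0..1} s *\<^sub>R (s ^ card B * (u' (s *\<^sub>R z) (s *\<^sub>R z) + real (card B + 1) * u (s *\<^sub>R z)))) =
      1 ^ (card B + 1) * u (1 *\<^sub>R z) - 0 ^ (card B + 1) * u (0 *\<^sub>R z)"
    proof (rule integral_FTC_atLeastAtMost)
      fix s :: real
      have "((\<lambda>s. u (s *\<^sub>R z)) has_derivative (\<lambda>h. u' (s *\<^sub>R z) (h *\<^sub>R z))) (at s)"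
        by (rule has_derivative_compose[OF _ u]) (auto intro!: derivative_eq_intros)
      then have "((\<lambda>s. u (s *\<^sub>R z)) has_field_derivative u' (s *\<^sub>R z) z) (at s)"
        unfolding has_field_derivative_def
        by (rule has_derivative_eq_rhs)
           (simp add: fun_eq_iff linear_scale[OF has_derivative_linear[OF u]] mult.commute)
      then have "((\<lambda>s. s ^ (card B + 1) * u (s *\<^sub>R z)) has_field_derivative
          (real (card B + 1) * s ^ card B) * u (s *\<^sub>R z) + u' (s *\<^sub>R z) z * s ^ (card B + 1)) (at s)"
        by (intro derivative_eq_intros | simp)+
      also have "(real (card B + 1) * s ^ card B) * u (s *\<^sub>R z) + u' (s *\<^sub>R z) z * s ^ (card B + 1) =
          s ^ card B * (u' (s *\<^sub>R z) (s *\<^sub>R z) + real (card B + 1) * u (s *\<^sub>R z))"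
        by (simp add: linear_scale[OF has_derivative_linear[OF u]] algebra_simps)
      finally show "((\<lambda>s. s ^ (card B + 1) * u (s *\<^sub>R z)) has_vector_derivative
          s ^ card B * (u' (s *\<^sub>R z) (s *\<^sub>R z) + real (card B + 1) * u (s *\<^sub>R z))) (at s within {0..1})"
        by (metis has_real_derivative_iff_has_vector_derivative has_vector_derivative_at_within)
    next
      show "continuous_on {0..1} (\<lambda>s. s ^ card B * (u' (s *\<^sub>R z) (s *\<^sub>R z) + real (card B + 1) * u (s *\<^sub>R z)))"
        by (intro continuous_intros continuous_on_compose2[OF u'] continuous_on_compose2[OF cu]) auto
    qed simp
    then show ?thesis by simp
  qed
  have "continuous_on UNIV (\<lambda>x. u' x x + real (card B + 1) * u x)"
    by (intro continuous_intros u' cu)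
  from cone_integral[OF B e K this S] show ?thesis by (simp only: inner)
qed

section \<open>Averages over faces\<close>

lemma tangent_space_eq:
  assumes "p \<in> F"
  shows "tangent_space F = span ((\<lambda>x. x - p) ` F)"
proof (rule antisym)
  have "x - y \<in> span ((\<lambda>x. x - p) ` F)" if "x \<in> F" "y \<in> F" for x y
    using span_diff[of "x - p" "(\<lambda>x. x - p) ` F" "y - p"] that by (auto intro: span_base)
  then show "tangent_space F \<subseteq> span ((\<lambda>x. x - p) ` F)"
    unfolding tangent_space_def by (intro span_minimal) auto
  show "span ((\<lambda>x. x - p) ` F) \<subseteq> tangent_space F"
    unfolding tangent_space_def using assms by (intro span_mono) auto
qed

lemma tangent_space_convex_hull:
  assumes "p \<in> C"
  shows "tangent_space (convex hull C) = span ((\<lambda>x. x - p) ` C)"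
proof -
  have "(\<lambda>x. x - p) ` (convex hull C) = convex hull ((\<lambda>x. x - p) ` C)"
    using convex_hull_translation[of "- p" C] by simp
  also have "span \<dots> = span ((\<lambda>x. x - p) ` C)"
    by (rule antisym) (simp_all add: span_minimal convex_hull_subset_span span_mono hull_subset)
  finally show ?thesis using assms by (subst tangent_space_eq[of p]) (auto intro: hull_inc)
qed

lemma tangent_basis_props:
  fixes F :: "(real^'n) set"
  shows "independent (tangent_basis F)" "span (tangent_basis F) = tangent_space F"
proof -
  have "subspace (tangent_space F)" by (simp add: tangent_space_def)
  then obtain B where "pairwise orthogonal B" "\<And>x. x \<in> B \<Longrightarrow> norm x = 1" "span B = tangent_space F"
    using orthonormal_basis_subspace by metis
  then have "\<exists>B. pairwise orthogonal B \<and> (\<forall>b\<in>B. norm b = 1) \<and> span B = tangent_space F" by blast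
  from someI_ex[OF this] have *: "pairwise orthogonal (tangent_basis F)" "\<forall>b\<in>tangent_basis F. norm b = 1"
      "span (tangent_basis F) = tangent_space F"
    by (simp_all add: tangent_basis_def)
  then show "span (tangent_basis F) = tangent_space F" by simp
  from * show "independent (tangent_basis F)"
    by (intro pairwise_orthogonal_independent) auto
qed

definition face_avg :: "(real^'n) set \<Rightarrow> (real^'n \<Rightarrow> real) \<Rightarrow> real" where
  "face_avg F u = 1 / measure (face_measure F) F * (LINT x:F|face_measure F. u x)"

lemma face_measure_eq:
  "face_measure F = distr (span_measure (tangent_basis F)) borel (\<lambda>y. (SOME x. x \<in> F) + y)"
  unfolding face_measure_def span_measure_def by (subst distr_distr) (auto simp: comp_def)

text \<open>Two points of \<open>F\<close> differ by a tangent vector, so translation invariance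
  replaces the chosen base point by any other.\<close>

lemma integral_face_measure:
  fixes f :: "real^'n \<Rightarrow> real"
  assumes p: "p \<in> F" and [measurable]: "f \<in> borel_measurable borel"
  shows "(LINT x|face_measure F. f x) = (LINT y|span_measure (tangent_basis F). f (p + y))"
proof -
  define q where "q = (SOME x. x \<in> F)"
  have q: "q \<in> F" unfolding q_def using p by (rule someI)
  then have "p - q \<in> span (tangent_basis F)"
    unfolding tangent_basis_props(2) tangent_space_eq[OF q] using p by (intro span_base) auto
  have "(LINT x|face_measure F. f x) = (LINT y|span_measure (tangent_basis F). f (q + y))"
    unfolding face_measure_eq q_def by (subst integral_distr) auto
  also have "\<dots> = (LINT y|span_measure (tangent_basis F). f (q + (y + (p - q))))"
    by (rule integral_span_measure_translate[OF tangent_basis_props(1) \<open>p - q \<in> _\<close>, symmetric]) measurable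
  finally show ?thesis by (simp add: algebra_simps)
qed

text \<open>A change of basis multiplies the measure by a constant \<open>c\<close>, which cancels
  in the quotient. This permits an oblique basis adapted to a facet.\<close>

lemma face_avg_eq:
  fixes u :: "real^'n \<Rightarrow> real"
  assumes p: "p \<in> F" and B: "independent B" "span B = tangent_space F"
    and [measurable]: "F \<in> sets borel" "u \<in> borel_measurable borel"
  shows "face_avg F u = (LINT y|span_measure B. indicator F (p + y) * u (p + y)) /
    (LINT y|span_measure B. indicator F (p + y))"
proof -
  obtain c where c: "c > 0" "span_measure (tangent_basis F) = density (span_measure B) (\<lambda>_. ennreal c)"
    using span_measure_unique[OF tangent_basis_props(1) B(1)] B(2) tangent_basis_props(2) by metis
  have int: "(LINT x|face_measure F. f x) = c * (LINT y|span_measure B. f (p + y))"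
    if [measurable]: "f \<in> borel_measurable borel" for f :: "real^'n \<Rightarrow> real"
  proof -
    have "(LINT y|span_measure (tangent_basis F). f (p + y)) = (LINT y|span_measure B. c *\<^sub>R f (p + y))"
      unfolding c(2) using c(1) by (intro integral_density) auto
    then show ?thesis using integral_face_measure[OF p that] by simp
  qed
  have "measure (face_measure F) F = (LINT x|face_measure F. indicator F x)"
    by (simp add: face_measure_def)
  also have "\<dots> = c * (LINT y|span_measure B. indicator F (p + y))"
    by (rule int) measurable
  finally show ?thesis using c(1)
    unfolding face_avg_def set_lebesgue_integral_def by (simp add: int)
qed

text \<open>Moving the base point to a relatively interior point \<open>q\<close> puts a ball of the
  tangent space inside the translate of \<open>F\<close>.\<close>

lemma face_integral_pos:
  fixes F :: "(real^'n) set"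
  assumes p: "p \<in> F" and B: "independent B" "span B = tangent_space F" and F: "compact F" "convex F"
  shows "(LINT y|span_measure B. indicator F (p + y)) > (0::real)"
proof -
  have [measurable]: "F \<in> sets borel" using F(1) by (rule borel_compact)
  obtain q e where q: "q \<in> F" "e > 0" "ball q e \<inter> affine hull F \<subseteq> F"
  proof -
    have "rel_interior F \<noteq> {}" using rel_interior_eq_empty[OF F(2)] p by auto
    then obtain q where "q \<in> rel_interior F" by blast
    then show ?thesis using that unfolding mem_rel_interior_ball by blast
  qed
  have "p - q \<in> span B" unfolding B(2) tangent_space_eq[OF q(1)] using p by (intro span_base) auto
  have "(LINT y|span_measure B. indicator F (p + y)) = (LINT y|span_measure B. indicator F (q + (y + (p - q))) :: real)"
    by (simp add: algebra_simps)
  also have "\<dots> = (LINT y|span_measure B. indicator F (q + y))"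
    by (rule integral_span_measure_translate[OF B(1) \<open>p - q \<in> _\<close>]) measurable
  also have "\<dots> = (LINT y|span_measure B. indicator ((\<lambda>y. q + y) -` F) y)"
    by (simp add: indicator_def)
  also have "\<dots> = measure (span_measure B) ((\<lambda>y. q + y) -` F)"
    by simp
  also have "\<dots> > 0"
  proof -
    have "(\<lambda>y. q + y) -` F = (\<lambda>x. - q + x) ` F" by (force simp: image_iff)
    then have "bounded ((\<lambda>y. q + y) -` F)"
      using compact_imp_bounded[OF F(1)] by (simp only: bounded_translation)
    then have fin: "emeasure (span_measure B) ((\<lambda>y. q + y) -` F) < \<infinity>"
      by (rule finite_span_measure_bounded[OF B(1)])
    have "emeasure (span_measure B) (ball 0 e) \<le> emeasure (span_measure B) ((\<lambda>y. q + y) -` F)"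
    proof (rule emeasure_mono_AE)
      show "AE y in span_measure B. y \<in> ball 0 e \<longrightarrow> y \<in> (\<lambda>y. q + y) -` F"
        using AE_span_measure
      proof eventually_elim
        case (elim y)
        have "q + y \<in> affine hull F"
        proof -
          have "(\<lambda>x. x - q) ` F \<subseteq> insert 0 ((\<lambda>x. - q + x) ` (F - {q}))" by auto
          then have "y \<in> span (insert 0 ((\<lambda>x. - q + x) ` (F - {q})))"
            using elim unfolding B(2) tangent_space_eq[OF q(1)] using span_mono by blast
          then show ?thesis unfolding affine_hull_span2[OF q(1)] by simp
        qed
        then show ?case using q(3) by (auto simp: dist_norm)
      qed
      show "(\<lambda>y. q + y) -` F \<in> sets (span_measure B)"
        using measurable_sets[of "\<lambda>y. q + y" borel borel F] by simp
    qed
    then have "emeasure (span_measure B) ((\<lambda>y. q + y) -` F) > 0"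
      using span_measure_ball_pos[OF B(1) q(2)] by (rule less_le_trans[rotated])
    with fin show ?thesis by (simp add: measure_def enn2real_positive_iff)
  qed
  finally show ?thesis .
qed

text \<open>Positivity of the measure excludes the default value 0 of a division by 0.\<close>

lemma face_avg_const:
  fixes F :: "(real^'n) set"
  assumes "F \<noteq> {}" "compact F" "convex F"
  shows "face_avg F (\<lambda>_. c) = c"
proof -
  obtain p where p: "p \<in> F" using assms(1) by blast
  show ?thesis
    using face_integral_pos[OF p tangent_basis_props assms(2,3)] borel_compact[OF assms(2)]
    by (subst face_avg_eq[OF p tangent_basis_props]) auto
qed

lemma face_avg_integrable:
  fixes u :: "real^'n \<Rightarrow> real"
  assumes "independent B" "compact F" "continuous_on UNIV u"
  shows "integrable (span_measure B) (\<lambda>y. indicator F (p + y) * u (p + y))"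
proof -
  have "(\<lambda>y. indicator F (p + y) * u (p + y)) = (\<lambda>y. indicator ((\<lambda>x. - p + x) ` F) y * u (p + y))"
    by (force simp: indicator_def fun_eq_iff image_iff)
  then show ?thesis
    using assms
    by (simp only:) (intro integrable_span_measure_compact compact_translation continuous_intros continuous_on_compose2[OF assms(3)], auto)
qed

lemma face_avg_linear:
  fixes u v :: "real^'n \<Rightarrow> real"
  assumes F: "F \<noteq> {}" "compact F" and u: "continuous_on UNIV u" and v: "continuous_on UNIV v"
  shows "face_avg F (\<lambda>x. a * u x + b * v x) = a * face_avg F u + b * face_avg F v"
proof -
  obtain p where p: "p \<in> F" using F(1) by blast
  note [measurable] = borel_compact[OF F(2)] borel_measurable_continuous_onI[OF u] borel_measurable_continuous_onI[OF v]
  let ?M = "span_measure (tangent_basis F)"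
  have "(LINT y|?M. indicator F (p + y) * (a * u (p + y) + b * v (p + y))) =
      (LINT y|?M. a * (indicator F (p + y) * u (p + y)) + b * (indicator F (p + y) * v (p + y)))"
    by (simp add: algebra_simps)
  also have "\<dots> = a * (LINT y|?M. indicator F (p + y) * u (p + y)) + b * (LINT y|?M. indicator F (p + y) * v (p + y))"
    using face_avg_integrable[OF tangent_basis_props(1) F(2)] u v by simp
  finally show ?thesis
    using p by (simp add: face_avg_eq[OF p tangent_basis_props] add_divide_distrib)
qed

text \<open>Euler's relation: \<open>div ((x - a) u) = (x - a) \<bullet> \<nabla>u + d u\<close>, and the field \<open>x - a\<close> is tangential to all
  facets through \<open>a\<close>, so that only the facet opposite to \<open>a\<close> contributes.\<close>

lemma face_avg_Euler:
  fixes C :: "(real^'n) set" and u :: "real^'n \<Rightarrow> real"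
  assumes C: "\<not> affine_dependent C" and a: "a \<in> C" and ne: "C - {a} \<noteq> {}"
    and u: "\<And>x. (u has_derivative u' x) (at x)" and u': "continuous_on UNIV (\<lambda>x. u' x (x - a))"
  shows "face_avg (convex hull C) (\<lambda>x. u' x (x - a)) =
    real (card C - 1) * (face_avg (convex hull (C - {a})) u - face_avg (convex hull C) u)"
proof -
  define F where "F = convex hull C"
  define G where "G = convex hull (C - {a})"
  have finC: "finite C" using C by (rule aff_independent_finite)
  obtain c where c: "c \<in> C - {a}" using ne by blast
  then have cG: "c \<in> G" and cF: "c \<in> F" by (auto simp: F_def G_def hull_inc)
  have aF: "a \<in> F" using a by (simp add: F_def hull_inc)
  have cpt: "compact F" "compact G" and cvx: "convex F" "convex G"
    using finC by (auto simp: F_def G_def finite_imp_compact_convex_hull)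
  note [measurable] = borel_compact[OF cpt(1)] borel_compact[OF cpt(2)]
  have cu: "continuous_on UNIV u"
    by (rule continuous_at_imp_continuous_on) (use u has_derivative_continuous in blast)
  note [measurable] = borel_measurable_continuous_onI[OF cu] borel_measurable_continuous_onI[OF u']
  \<comment> \<open>With \<open>a\<close> moved to the origin, \<open>F\<close> becomes the cone
    over the opposite facet \<open>G\<close>, whose translate is \<open>e + K\<close> with
    \<open>K\<close> in the tangent space of \<open>G\<close>. The vectors \<open>insert e B\<close>
    form a basis of the tangent space of \<open>F\<close>, usually not an orthogonal one.\<close>
  define B where "B = tangent_basis G"
  define e where "e = c - a"
  have B: "independent B" "span B = tangent_space G" by (simp_all add: B_def tangent_basis_props)
  have TG: "tangent_space G = span ((\<lambda>x. x - c) ` (C - {a}))"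
    unfolding G_def by (rule tangent_space_convex_hull[OF c])
  have TF: "tangent_space F = span ((\<lambda>x. x - c) ` C)"
    unfolding F_def using c by (intro tangent_space_convex_hull) auto
  have e: "e \<notin> span B"
  proof
    assume "e \<in> span B"
    then have "a - c \<in> tangent_space G" using span_neg[of e B] by (simp add: e_def B(2))
    moreover have "(\<lambda>x. x - c) ` (C - {a}) \<subseteq> insert 0 ((\<lambda>x. - c + x) ` (C - {a} - {c}))" by auto
    ultimately have "a - c \<in> span (insert 0 ((\<lambda>x. - c + x) ` (C - {a} - {c})))"
      unfolding TG using span_mono by blast
    then have "c + (a - c) \<in> affine hull (C - {a})"
      unfolding affine_hull_span2[OF c] by (intro imageI) simp
    then show False using C a by (auto simp: affine_dependent_def)
  qed
  have eB: "independent (insert e B)" using B(1) e by (simp add: independent_insertI)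
  have sp: "span (insert e B) = tangent_space F"
  proof -
    have "(\<lambda>x. x - c) ` C = insert (- e) ((\<lambda>x. x - c) ` (C - {a}))" using a by (auto simp: e_def)
    moreover have "span (insert (- e) ((\<lambda>x. x - c) ` (C - {a}))) = span (insert e ((\<lambda>x. x - c) ` (C - {a})))"
      unfolding span_insert by (auto intro: exI[of _ "- _"])
    moreover have "span (insert e ((\<lambda>x. x - c) ` (C - {a}))) = span (insert e B)"
      unfolding span_insert[of e] TG[symmetric] B(2) by simp
    ultimately show ?thesis unfolding TF by simp
  qed
  have card: "card B + 1 = card C - 1"
  proof -
    have "int (card (insert e B)) = int (dim (tangent_space F))"
      using eB sp by (metis dim_span dim_eq_card_independent)
    also have "\<dots> = aff_dim C"
      unfolding TF dim_span using c by (subst aff_dim_eq_dim_subtract[of c]) (auto intro: hull_inc)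
    also have "\<dots> = int (card C) - 1" using aff_dim_affine_independent[OF C] by simp
    finally have "int (card (insert e B)) = int (card C) - 1" .
    moreover have "e \<notin> B" using e span_base by blast
    ultimately show ?thesis using independent_imp_finite[OF B(1)] by simp
  qed
  define K where "K = (\<lambda>z. z - c) ` G"
  define S where "S = (\<lambda>x. x - a) ` F"
  have K: "compact K" "K \<subseteq> span B"
    using cpt(2) unfolding K_def B(2) tangent_space_eq[OF cG]
    by (auto intro: span_base simp: compact_translation_subtract)
  have S: "S = (\<lambda>(s, w). s *\<^sub>R (e + w)) ` ({0..1} \<times> K)"
  proof -
    have "convex hull (insert a (C - {a})) = {(1 - s) *\<^sub>R a + s *\<^sub>R x |x s. 0 \<le> s \<and> s \<le> 1 \<and> x \<in> G}"
      using ne by (subst convex_hull_insert_alt) (simp add: G_def)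
    then have F: "F = {(1 - s) *\<^sub>R a + s *\<^sub>R x |x s. 0 \<le> s \<and> s \<le> 1 \<and> x \<in> G}"
      using a by (simp add: F_def insert_absorb)
    show ?thesis
    proof (rule antisym)
      show "S \<subseteq> (\<lambda>(s, w). s *\<^sub>R (e + w)) ` ({0..1} \<times> K)"
      proof
        fix y assume "y \<in> S"
        then obtain s x where "y = (1 - s) *\<^sub>R a + s *\<^sub>R x - a" "0 \<le> s" "s \<le> 1" "x \<in> G"
          unfolding S_def F by auto
        then show "y \<in> (\<lambda>(s, w). s *\<^sub>R (e + w)) ` ({0..1} \<times> K)"
          by (intro image_eqI[of _ _ "(s, x - c)"]) (auto simp: K_def e_def algebra_simps)
      qed
      show "(\<lambda>(s, w). s *\<^sub>R (e + w)) ` ({0..1} \<times> K) \<subseteq> S"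
      proof clarify
        fix s w assume "s \<in> {0..1::real}" "w \<in> K"
        then obtain x where "x \<in> G" "w = x - c" by (auto simp: K_def)
        then have "s *\<^sub>R (e + w) = ((1 - s) *\<^sub>R a + s *\<^sub>R x) - a" by (simp add: e_def algebra_simps)
        then show "s *\<^sub>R (e + w) \<in> S" unfolding S_def F using \<open>s \<in> _\<close> \<open>x \<in> G\<close> by (auto intro!: imageI)
      qed
    qed
  qed
  have indS: "indicator S y = (indicator F (a + y) :: real)" for y
    unfolding S_def by (force simp: indicator_def image_iff)
  have indK: "indicator K y = (indicator G (c + y) :: real)" for y
    unfolding K_def by (force simp: indicator_def image_iff)
  let ?I = "\<lambda>v. LINT y|span_measure (insert e B). indicator F (a + y) * v (a + y)"
  let ?J = "\<lambda>v. LINT y|span_measure B. indicator G (c + y) * v (c + y)"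
  have Euler: "?I (\<lambda>x. v' x (x - a)) + real (card C - 1) * ?I v = ?J v"
    if v: "\<And>x. (v has_derivative v' x) (at x)" and v': "continuous_on UNIV (\<lambda>x. v' x (x - a))"
    for v :: "real^'n \<Rightarrow> real" and v'
  proof -
    have cv: "continuous_on UNIV v"
      by (rule continuous_at_imp_continuous_on) (use v has_derivative_continuous in blast)
    have d: "((\<lambda>y. v (a + y)) has_derivative v' (a + y)) (at y)" for y
    proof -
      have "((\<lambda>y. a + y) has_derivative (\<lambda>h. h)) (at y)" by (auto intro!: derivative_eq_intros)
      from has_derivative_compose[OF this v] show ?thesis .
    qed
    have cd: "continuous_on UNIV (\<lambda>y. v' (a + y) y)"
      using continuous_on_compose2[OF v', of UNIV "\<lambda>y. a + y"] by (simp add: continuous_intros)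
    have "?I (\<lambda>x. v' x (x - a)) + real (card C - 1) * ?I v =
        (LINT y|span_measure (insert e B). indicator F (a + y) * v' (a + y) y) +
        (LINT y|span_measure (insert e B). real (card C - 1) * (indicator F (a + y) * v (a + y)))"
      by simp
    also have "\<dots> = (LINT y|span_measure (insert e B). indicator F (a + y) * v' (a + y) y +
         real (card C - 1) * (indicator F (a + y) * v (a + y)))"
      using face_avg_integrable[OF eB cpt(1) v', of a] face_avg_integrable[OF eB cpt(1) cv, of a]
      by (subst Bochner_Integration.integral_add) auto
    also have "\<dots> = (LINT y|span_measure (insert e B). indicator S y * (v' (a + y) y + real (card B + 1) * v (a + y)))"
      unfolding indS card by (simp add: algebra_simps)
    also have "\<dots> = (LINT w|span_measure B. indicator K w * v (a + (e + w)))"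
      by (rule cone_integral_Euler[OF B(1) e K d cd S])
    also have "\<dots> = ?J v" unfolding indK by (simp add: e_def)
    finally show ?thesis .
  qed
  \<comment> \<open>The identity for the constant 1 is the volume formula of the cone, in
    coordinates in which the height is 1. It converts the integral over \<open>G\<close> into an
    average.\<close>
  have one: "real (card C - 1) * (LINT y|span_measure (insert e B). indicator F (a + y)) =
      (LINT y|span_measure B. indicator G (c + y))"
    using Euler[of "\<lambda>_. 1" "\<lambda>_ _. 0"] by simp
  have pos: "(LINT y|span_measure (insert e B). indicator F (a + y)) > (0::real)"
    by (rule face_integral_pos[OF aF eB sp cpt(1) cvx(1)])
  have pos': "(LINT y|span_measure B. indicator G (c + y)) > (0::real)"
    by (rule face_integral_pos[OF cG B cpt(2) cvx(2)])
  \<comment> \<open>\<open>X\<close>, \<open>U\<close> and \<open>V\<close> stand for the integrals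
    over \<open>F\<close> of the derivative, of \<open>u\<close> and of 1, and \<open>J\<close> for
    that of \<open>u\<close> over \<open>G\<close>; \<open>d * V\<close> is the measure of
    \<open>G\<close> by the preceding volume formula.\<close>
  have arith: "X / V = d * (J / (d * V) - U / V)" if "X + d * U = J" "V > 0" "d > 0" for X V d J U :: real
    unfolding that(1)[symmetric] using that(2,3) by (simp add: field_simps)
  have "face_avg F (\<lambda>x. u' x (x - a)) = real (card C - 1) * (face_avg G u - face_avg F u)"
    unfolding face_avg_eq[OF aF eB sp borel_compact[OF cpt(1)] borel_measurable_continuous_onI[OF cu]]
      face_avg_eq[OF aF eB sp borel_compact[OF cpt(1)] borel_measurable_continuous_onI[OF u']]
      face_avg_eq[OF cG B borel_compact[OF cpt(2)] borel_measurable_continuous_onI[OF cu]]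
    unfolding one[symmetric]
  proof (rule arith[OF Euler[OF u u'] pos])
    show "real (card C - 1) > 0" using pos' unfolding one[symmetric] using pos by (simp add: zero_less_mult_iff)
  qed
  then show ?thesis by (simp add: F_def G_def)
qed

text \<open>Subtract Euler's relations at \<open>a\<close> and at \<open>b\<close>, using
  \<open>b - a = (x - a) - (x - b)\<close>: the averages of \<open>u\<close> over the whole face
  cancel.\<close>

lemma face_avg_edge_derivative:
  fixes C :: "(real^'n) set" and u :: "real^'n \<Rightarrow> real"
  assumes C: "\<not> affine_dependent C" and ab: "a \<in> C" "b \<in> C" "a \<noteq> b"
    and u: "\<And>x. (u has_derivative u' x) (at x)" and u': "\<And>w. continuous_on UNIV (\<lambda>x. u' x w)"
  shows "face_avg (convex hull C) (\<lambda>x. u' x (b - a)) =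
    real (card C - 1) * (face_avg (convex hull (C - {a})) u - face_avg (convex hull (C - {b})) u)"
proof -
  \<comment> \<open>Continuity is assumed for fixed directions; expansion in the standard basis
    extends it to the direction \<open>x - p\<close>, which varies with the point.\<close>
  have cont: "continuous_on UNIV (\<lambda>x. u' x (x - p))" for p
  proof -
    have "u' x (x - p) = (\<Sum>i\<in>Basis. ((x - p) \<bullet> i) * u' x i)" for x
    proof -
      have "u' x (\<Sum>i\<in>Basis. ((x - p) \<bullet> i) *\<^sub>R i) = (\<Sum>i\<in>Basis. ((x - p) \<bullet> i) * u' x i)"
        using has_derivative_linear[OF u] by (simp add: linear_sum linear_scale)
      then show ?thesis by (simp only: euclidean_representation)
    qed
    then show ?thesis by (simp only:) (intro continuous_intros u')
  qed
  have "u' x (b - a) = 1 * u' x (x - a) + (- 1) * u' x (x - b)" for x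
    using linear_diff[OF has_derivative_linear[OF u], of x "x - a" "x - b"] by simp
  then have "face_avg (convex hull C) (\<lambda>x. u' x (b - a)) =
      face_avg (convex hull C) (\<lambda>x. u' x (x - a)) - face_avg (convex hull C) (\<lambda>x. u' x (x - b))"
    using face_avg_linear[OF _ _ cont cont, of "convex hull C" 1 a "-1" b] ab aff_independent_finite[OF C]
    by (auto simp: finite_imp_compact_convex_hull)
  moreover have "C - {a} \<noteq> {}" "C - {b} \<noteq> {}" using ab by auto
  ultimately show ?thesis
    using face_avg_Euler[OF C ab(1) _ u cont] face_avg_Euler[OF C ab(2) _ u cont]
    by (simp add: algebra_simps)
qed

section \<open>Polynomials in terms of their coefficients\<close>

definition weak_compositions :: "'a set \<Rightarrow> nat \<Rightarrow> ('a \<Rightarrow> nat) set" where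
  "weak_compositions A s = {\<beta>. (\<forall>i. i \<notin> A \<longrightarrow> \<beta> i = 0) \<and> (\<Sum>i\<in>A. \<beta> i) = s}"

lemma weak_compositions_insert:
  assumes "finite A" "a \<notin> A"
  shows "weak_compositions (insert a A) s = (\<Union>t\<le>s. (\<lambda>\<beta>. \<beta>(a := s - t)) ` weak_compositions A t)"
proof (rule antisym)
  show "weak_compositions (insert a A) s \<subseteq> (\<Union>t\<le>s. (\<lambda>\<beta>. \<beta>(a := s - t)) ` weak_compositions A t)"
  proof
    fix \<beta> assume \<beta>: "\<beta> \<in> weak_compositions (insert a A) s"
    have eq: "(\<Sum>i\<in>A. (\<beta>(a := 0)) i) = (\<Sum>i\<in>A. \<beta> i)"
      using assms(2) by (intro sum.cong) auto
    have *: "\<beta> a + (\<Sum>i\<in>A. \<beta> i) = s" using \<beta> assms by (simp add: weak_compositions_def)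
    then have "\<beta> = (\<beta>(a := 0))(a := s - (\<Sum>i\<in>A. \<beta> i))" by auto
    moreover have "\<beta>(a := 0) \<in> weak_compositions A (\<Sum>i\<in>A. \<beta> i)"
      using \<beta> eq by (auto simp: weak_compositions_def)
    ultimately show "\<beta> \<in> (\<Union>t\<le>s. (\<lambda>\<beta>. \<beta>(a := s - t)) ` weak_compositions A t)"
      using * by (intro UN_I[of "\<Sum>i\<in>A. \<beta> i"] image_eqI) auto
  qed
  show "(\<Union>t\<le>s. (\<lambda>\<beta>. \<beta>(a := s - t)) ` weak_compositions A t) \<subseteq> weak_compositions (insert a A) s"
  proof clarify
    fix t \<beta> assume t: "t \<le> s" and \<beta>: "\<beta> \<in> weak_compositions A t"
    have eq: "(\<Sum>i\<in>A. (\<beta>(a := s - t)) i) = (\<Sum>i\<in>A. \<beta> i)"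
      using assms(2) by (intro sum.cong) auto
    have "(\<Sum>i\<in>insert a A. (\<beta>(a := s - t)) i) = s"
      unfolding sum.insert[OF assms] eq using \<beta> t by (simp add: weak_compositions_def)
    then show "\<beta>(a := s - t) \<in> weak_compositions (insert a A) s" using \<beta> by (auto simp: weak_compositions_def)
  qed
qed

text \<open>Split by the total \<open>t\<close> that remains outside the new element; the counts add
  up by the hockey-stick identity. Writing the size as \<open>Suc r\<close> keeps
  \<open>r + s\<close> free of truncated subtraction.\<close>

lemma card_weak_compositions:
  assumes "finite A" "card A = Suc r"
  shows "finite (weak_compositions A s) \<and> card (weak_compositions A s) = (r + s) choose s"
  using assms
proof (induction A arbitrary: r s rule: finite_induct)
  case empty
  then show ?case by simp
next
  case (insert a A)
  show ?case
  proof (cases "A = {}")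
    case True
    then have "weak_compositions (insert a A) s = {(\<lambda>_. 0)(a := s)}" by (auto simp: weak_compositions_def fun_eq_iff)
    then show ?thesis using insert True by simp
  next
    case False
    then obtain r' where r': "card A = Suc r'" using insert.hyps(1) by (metis card_eq_0_iff not0_implies_Suc)
    with insert have r: "r = Suc r'" by simp
    note IH = insert.IH[OF r']
    \<comment> \<open>The overwritten value is no information: compositions over \<open>A\<close>
      are 0 at \<open>a\<close>.\<close>
    have inj: "inj_on (\<lambda>\<beta>. \<beta>(a := s - t)) (weak_compositions A t)" for t
    proof (rule inj_onI)
      fix \<beta> \<gamma> assume *: "\<beta> \<in> weak_compositions A t" "\<gamma> \<in> weak_compositions A t" "\<beta>(a := s - t) = \<gamma>(a := s - t)"
      then have "\<beta> a = \<gamma> a" using insert.hyps(2) by (simp add: weak_compositions_def)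
      then show "\<beta> = \<gamma>" using *(3) by (metis fun_upd_triv fun_upd_upd)
    qed
    have "card (weak_compositions (insert a A) s) = (\<Sum>t\<le>s. card ((\<lambda>\<beta>. \<beta>(a := s - t)) ` weak_compositions A t))"
      unfolding weak_compositions_insert[OF insert.hyps(1,2)]
    proof (rule card_UN_disjoint)
      show "\<forall>i\<in>{..s}. \<forall>j\<in>{..s}. i \<noteq> j \<longrightarrow> (\<lambda>\<beta>. \<beta>(a := s - i)) ` weak_compositions A i \<inter> (\<lambda>\<beta>. \<beta>(a := s - j)) ` weak_compositions A j = {}"
        by (auto simp: fun_eq_iff) (metis diff_diff_cancel)
    qed (use IH in auto)
    also have "\<dots> = (\<Sum>t\<le>s. (r' + t) choose t)"
      by (intro sum.cong refl) (simp add: card_image[OF inj] IH)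
    also have "\<dots> = (r + s) choose s" by (simp add: sum_choose_lower r)
    finally have "card (weak_compositions (insert a A) s) = (r + s) choose s" .
    moreover have "finite (weak_compositions (insert a A) s)"
      unfolding weak_compositions_insert[OF insert.hyps(1,2)] using IH by auto
    ultimately show ?thesis by simp
  qed
qed

lemma card_exponents:
  "card {\<beta> :: 'n::finite \<Rightarrow> nat. (\<Sum>i\<in>UNIV. \<beta> i) \<le> m} = (CARD('n) + m) choose m"
proof -
  obtain r where r: "CARD('n) = Suc r" using not0_implies_Suc[of "CARD('n)"] by auto
  have "{\<beta> :: 'n \<Rightarrow> nat. (\<Sum>i\<in>UNIV. \<beta> i) \<le> m} = (\<Union>t\<le>m. weak_compositions UNIV t)"
    by (auto simp: weak_compositions_def)
  also have "card \<dots> = (\<Sum>t\<le>m. card (weak_compositions (UNIV :: 'n set) t))"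
    by (rule card_UN_disjoint) (auto simp: card_weak_compositions[OF finite_class.finite_UNIV r], auto simp: weak_compositions_def)
  also have "\<dots> = (\<Sum>t\<le>m. (r + t) choose t)"
    by (simp add: card_weak_compositions[OF finite_class.finite_UNIV r])
  also have "\<dots> = (CARD('n) + m) choose m" by (simp add: sum_choose_lower r)
  finally show ?thesis .
qed

section \<open>Directional derivatives acting on coefficients\<close>

definition monom_fun :: "('n \<Rightarrow> nat) \<Rightarrow> real^'n \<Rightarrow> real" where
  "monom_fun \<beta> x = (\<Prod>i\<in>UNIV. x $ i ^ \<beta> i)"

definition poly_fun :: "nat \<Rightarrow> (('n \<Rightarrow> nat) \<Rightarrow> real) \<Rightarrow> real^'n \<Rightarrow> real" where
  "poly_fun m c x = (\<Sum>\<beta> | (\<Sum>i\<in>UNIV. \<beta> i) \<le> m. c \<beta> * monom_fun \<beta> x)"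

text \<open>Separates the actual degree from the range of summation of \<open>poly_fun m\<close>,
  which stays fixed while differentiation lowers the degree.\<close>

definition deg_le :: "nat \<Rightarrow> (('n::finite \<Rightarrow> nat) \<Rightarrow> real) \<Rightarrow> bool" where
  "deg_le j c \<longleftrightarrow> (\<forall>\<beta>. j < (\<Sum>i\<in>UNIV. \<beta> i) \<longrightarrow> c \<beta> = 0)"

text \<open>The coefficients of the derivative along \<open>w\<close>. On this side the symmetry of
  mixed derivatives, the loss of degree and linearity in the direction are finite algebraic
  identities.\<close>

definition coeff_deriv :: "real^'n \<Rightarrow> (('n \<Rightarrow> nat) \<Rightarrow> real) \<Rightarrow> ('n \<Rightarrow> nat) \<Rightarrow> real" where
  "coeff_deriv w c \<beta> = (\<Sum>i\<in>UNIV. w $ i * (real (\<beta> i + 1) * c (\<beta>(i := \<beta> i + 1))))"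

lemma sum_fun_upd:
  fixes \<beta> :: "'n::finite \<Rightarrow> nat"
  shows "(\<Sum>j\<in>UNIV. (\<beta>(i := k)) j) + \<beta> i = (\<Sum>j\<in>UNIV. \<beta> j) + k"
proof -
  have "(\<Sum>j\<in>UNIV. (\<beta>(i := k)) j) = k + (\<Sum>j\<in>UNIV - {i}. (\<beta>(i := k)) j)"
    by (subst sum.remove[of _ i]) auto
  also have "(\<Sum>j\<in>UNIV - {i}. (\<beta>(i := k)) j) = (\<Sum>j\<in>UNIV - {i}. \<beta> j)"
    by (intro sum.cong) auto
  finally show ?thesis by (subst sum.remove[of UNIV i \<beta>]) auto
qed

lemma sum_fun_upd_Suc:
  fixes \<beta> :: "'n::finite \<Rightarrow> nat"
  shows "(\<Sum>j\<in>UNIV. (\<beta>(i := \<beta> i + 1)) j) = (\<Sum>j\<in>UNIV. \<beta> j) + 1"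
  using sum_fun_upd[of \<beta> i "\<beta> i + 1"] by linarith

text \<open>Coefficients beyond degree \<open>m\<close> never enter the sum. Normalising them to 0
  allows injectivity to be shown by comparing coefficients.\<close>

lemma poly_space_eq: "(poly_space m :: (real^'n \<Rightarrow> real) set) = {poly_fun m c | c. deg_le m c}"
proof -
  have 1: "poly_fun m c = poly_fun m (\<lambda>\<beta>. if (\<Sum>i\<in>UNIV. \<beta> i) \<le> m then c \<beta> else 0)" for c :: "('n::finite \<Rightarrow> nat) \<Rightarrow> real"
    by (auto simp: poly_fun_def fun_eq_iff intro!: sum.cong)
  have 2: "deg_le m (\<lambda>\<beta>. if (\<Sum>i\<in>UNIV. \<beta> i) \<le> m then c \<beta> else 0)" for c :: "('n::finite \<Rightarrow> nat) \<Rightarrow> real"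
    by (auto simp: deg_le_def)
  have "(poly_space m :: (real^'n \<Rightarrow> real) set) = range (poly_fun m)"
    unfolding poly_space_def poly_fun_def[abs_def] monom_fun_def[abs_def] by blast
  also have "\<dots> = {poly_fun m c | c. deg_le m c}"
  proof (rule antisym)
    show "range (poly_fun m) \<subseteq> {poly_fun m c | c :: ('n \<Rightarrow> nat) \<Rightarrow> real. deg_le m c}"
    proof clarify
      fix c :: "('n \<Rightarrow> nat) \<Rightarrow> real"
      show "\<exists>c'. poly_fun m c = poly_fun m c' \<and> deg_le m c'" by (intro exI conjI, rule 1, rule 2)
    qed
  qed blast
  finally show ?thesis .
qed

lemma has_derivative_monom_fun:
  "(monom_fun \<beta> has_derivative (\<lambda>w. \<Sum>i\<in>UNIV. w $ i * (real (\<beta> i) * monom_fun (\<beta>(i := \<beta> i - 1)) x))) (at x)"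
proof -
  have "((\<lambda>x. \<Prod>i\<in>UNIV. x $ i ^ \<beta> i) has_derivative
     (\<lambda>w. \<Sum>i\<in>UNIV. (real (\<beta> i) * (w $ i) * (x $ i) ^ (\<beta> i - 1)) * (\<Prod>j\<in>UNIV - {i}. x $ j ^ \<beta> j))) (at x)"
  proof (rule has_derivative_prod)
    fix i
    have "((\<lambda>x. x $ i) has_derivative (\<lambda>w. w $ i)) (at x)"
      by (rule bounded_linear_imp_has_derivative[OF bounded_linear_vec_nth])
    from has_derivative_power[OF this]
    show "((\<lambda>x. x $ i ^ \<beta> i) has_derivative (\<lambda>w. real (\<beta> i) * (w $ i) * (x $ i) ^ (\<beta> i - 1))) (at x)" .
  qed
  moreover have "monom_fun (\<beta>(i := \<beta> i - 1)) x = (x $ i) ^ (\<beta> i - 1) * (\<Prod>j\<in>UNIV - {i}. x $ j ^ \<beta> j)" for i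
    unfolding monom_fun_def by (subst prod.remove[of _ i]) auto
  ultimately show ?thesis by (simp add: monom_fun_def[abs_def] algebra_simps)
qed

text \<open>A shift of the \<open>i\<close>-th exponent by one. Exponents pushed out of the range
  have coefficient 0 by \<open>deg_le\<close>, and those with \<open>\<beta> i = 0\<close>, which
  the shift does not reach, carry the factor 0.\<close>

lemma poly_fun_coeff_deriv:
  assumes "deg_le m c"
  shows "poly_fun m (coeff_deriv w c) x = (\<Sum>\<beta> | (\<Sum>i\<in>UNIV. \<beta> i) \<le> m.
    c \<beta> * (\<Sum>i\<in>UNIV. w $ i * (real (\<beta> i) * monom_fun (\<beta>(i := \<beta> i - 1)) x)))"
proof -
  let ?E = "{\<beta> :: 'a \<Rightarrow> nat. (\<Sum>i\<in>UNIV. \<beta> i) \<le> m}"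
  have "(\<Sum>\<beta>\<in>?E. real (\<beta> i + 1) * c (\<beta>(i := \<beta> i + 1)) * monom_fun \<beta> x) =
      (\<Sum>\<beta>\<in>?E. c \<beta> * (real (\<beta> i) * monom_fun (\<beta>(i := \<beta> i - 1)) x))" for i
  proof -
    have "(\<Sum>\<beta>\<in>?E. real (\<beta> i + 1) * c (\<beta>(i := \<beta> i + 1)) * monom_fun \<beta> x) =
        (\<Sum>\<beta>\<in>{\<beta>\<in>?E. \<beta>(i := \<beta> i + 1) \<in> ?E}. real (\<beta> i + 1) * c (\<beta>(i := \<beta> i + 1)) * monom_fun \<beta> x)"
    proof (intro sum.mono_neutral_right finite_exponents ballI)
      fix \<beta> assume "\<beta> \<in> ?E - {\<beta>\<in>?E. \<beta>(i := \<beta> i + 1) \<in> ?E}"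
      then have "m < (\<Sum>j\<in>UNIV. (\<beta>(i := \<beta> i + 1)) j)" by (simp only: mem_Collect_eq Diff_iff not_le[symmetric]) blast
      then have "c (\<beta>(i := \<beta> i + 1)) = 0" using assms unfolding deg_le_def by blast
      then show "real (\<beta> i + 1) * c (\<beta>(i := \<beta> i + 1)) * monom_fun \<beta> x = 0" by simp
    qed blast
    also have "\<dots> = (\<Sum>\<beta>\<in>{\<beta>\<in>?E. \<beta> i > 0}. c \<beta> * (real (\<beta> i) * monom_fun (\<beta>(i := \<beta> i - 1)) x))"
    proof (rule sum.reindex_bij_witness[of _ "\<lambda>\<beta>. \<beta>(i := \<beta> i - 1)" "\<lambda>\<beta>. \<beta>(i := \<beta> i + 1)"])
      fix \<beta> assume "\<beta> \<in> {\<beta> \<in> ?E. 0 < \<beta> i}"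
      then have \<beta>: "(\<Sum>j\<in>UNIV. \<beta> j) \<le> m" "\<beta> i > 0" by auto
      have "(\<Sum>j\<in>UNIV. (\<beta>(i := \<beta> i - 1)) j) \<le> m"
        using sum_fun_upd[of \<beta> i "\<beta> i - 1"] \<beta> by linarith
      moreover have "(\<beta>(i := \<beta> i - 1))(i := (\<beta>(i := \<beta> i - 1)) i + 1) = \<beta>"
        using \<beta>(2) by (auto simp: fun_eq_iff)
      ultimately show "\<beta>(i := \<beta> i - 1) \<in> {\<beta> \<in> ?E. \<beta>(i := \<beta> i + 1) \<in> ?E}"
        using \<beta>(1) by (simp only: mem_Collect_eq)
    qed (auto simp del: One_nat_def)
    also have "\<dots> = (\<Sum>\<beta>\<in>?E. c \<beta> * (real (\<beta> i) * monom_fun (\<beta>(i := \<beta> i - 1)) x))"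
      by (intro sum.mono_neutral_left finite_exponents) auto
    finally show ?thesis .
  qed
  then have "(\<Sum>i\<in>UNIV. w $ i * (\<Sum>\<beta>\<in>?E. real (\<beta> i + 1) * c (\<beta>(i := \<beta> i + 1)) * monom_fun \<beta> x)) =
    (\<Sum>i\<in>UNIV. w $ i * (\<Sum>\<beta>\<in>?E. c \<beta> * (real (\<beta> i) * monom_fun (\<beta>(i := \<beta> i - 1)) x)))" by simp
  then show ?thesis
    unfolding poly_fun_def coeff_deriv_def sum_distrib_left sum_distrib_right
    by (subst sum.swap, subst (2) sum.swap) (simp add: ac_simps)
qed

lemma has_derivative_poly_fun:
  assumes "deg_le m c"
  shows "(poly_fun m c has_derivative (\<lambda>w. poly_fun m (coeff_deriv w c) x)) (at x)"
  unfolding poly_fun_coeff_deriv[OF assms] unfolding poly_fun_def[abs_def]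
  by (intro has_derivative_sum has_derivative_mult_right has_derivative_monom_fun)

lemma dir_deriv_poly_fun:
  assumes "deg_le m c"
  shows "dir_deriv w (poly_fun m c) = poly_fun m (coeff_deriv w c)"
  unfolding dir_deriv_def by (simp add: frechet_derivative_at[OF has_derivative_poly_fun[OF assms], symmetric])

lemma continuous_poly_fun: "continuous_on S (poly_fun m c)"
  unfolding poly_fun_def[abs_def] monom_fun_def by (intro continuous_intros)

lemma deg_le_mono: "deg_le j c \<Longrightarrow> j \<le> k \<Longrightarrow> deg_le k c"
  by (auto simp: deg_le_def)

lemma deg_le_coeff_deriv:
  fixes c :: "('n::finite \<Rightarrow> nat) \<Rightarrow> real"
  assumes "deg_le j c"
  shows "deg_le (j - 1) (coeff_deriv w c)"
  unfolding deg_le_def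
proof (intro allI impI)
  fix \<beta> :: "'n \<Rightarrow> nat" assume \<beta>: "j - 1 < (\<Sum>i\<in>UNIV. \<beta> i)"
  have "c (\<beta>(i := \<beta> i + 1)) = 0" for i
  proof -
    have "j < (\<Sum>j\<in>UNIV. (\<beta>(i := \<beta> i + 1)) j)" using sum_fun_upd_Suc[of \<beta> i] \<beta> by linarith
    then show ?thesis using assms unfolding deg_le_def by blast
  qed
  then show "coeff_deriv w c \<beta> = 0" unfolding coeff_deriv_def by simp
qed

lemma coeff_deriv_commute: "coeff_deriv w (coeff_deriv z c) = coeff_deriv z (coeff_deriv w c)"
proof
  fix \<beta>
  define g where "g i j = real (\<beta> i + 1) * real ((\<beta>(i := \<beta> i + 1)) j + 1) *
    c ((\<beta>(i := \<beta> i + 1))(j := (\<beta>(i := \<beta> i + 1)) j + 1))" for i j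
  have sym: "g i j = g j i" for i j
    by (cases "i = j") (auto simp: g_def fun_upd_twist)
  have eq: "coeff_deriv w (coeff_deriv z c) \<beta> = (\<Sum>i\<in>UNIV. \<Sum>j\<in>UNIV. w $ i * z $ j * g i j)" for w z
    unfolding coeff_deriv_def g_def sum_distrib_left by (intro sum.cong refl) (simp only: ac_simps)
  show "coeff_deriv w (coeff_deriv z c) \<beta> = coeff_deriv z (coeff_deriv w c) \<beta>"
    unfolding eq by (subst sum.swap) (simp add: sym ac_simps)
qed

lemma coeff_deriv_linear_dir:
  "coeff_deriv (a *\<^sub>R w + b *\<^sub>R z) c = (\<lambda>\<beta>. a * coeff_deriv w c \<beta> + b * coeff_deriv z c \<beta>)"
  by (simp add: coeff_deriv_def fun_eq_iff algebra_simps sum.distrib sum_distrib_left)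

lemma coeff_deriv_linear:
  "coeff_deriv w (\<lambda>\<beta>. a * c \<beta> + b * d \<beta>) = (\<lambda>\<beta>. a * coeff_deriv w c \<beta> + b * coeff_deriv w d \<beta>)"
  by (simp add: coeff_deriv_def fun_eq_iff algebra_simps sum.distrib sum_distrib_left)

lemma poly_fun_linear: "poly_fun m (\<lambda>\<beta>. a * c \<beta> + b * d \<beta>) = (\<lambda>x. a * poly_fun m c x + b * poly_fun m d x)"
  by (simp add: poly_fun_def fun_eq_iff algebra_simps sum.distrib sum_distrib_left)

abbreviation coeff_derivs :: "(real^'n) list \<Rightarrow> (('n \<Rightarrow> nat) \<Rightarrow> real) \<Rightarrow> ('n \<Rightarrow> nat) \<Rightarrow> real" where
  "coeff_derivs \<equiv> foldr coeff_deriv"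

lemma deg_le_coeff_derivs: "deg_le j c \<Longrightarrow> deg_le (j - length ws) (coeff_derivs ws c)"
proof (induction ws)
  case (Cons w ws)
  from deg_le_coeff_deriv[OF Cons.IH[OF Cons.prems], of w] show ?case by simp
qed simp

lemma coeff_derivs_linear:
  "coeff_derivs ws (\<lambda>\<beta>. a * c \<beta> + b * d \<beta>) = (\<lambda>\<beta>. a * coeff_derivs ws c \<beta> + b * coeff_derivs ws d \<beta>)"
  by (induction ws) (simp_all add: coeff_deriv_linear)

text \<open>Mixed derivatives depend only on the multiset of directions. This allows an edge to be
  brought to the front of a word and a word of normals to be sorted into a multi-index.\<close>

lemma coeff_derivs_mset: "mset ws = mset vs \<Longrightarrow> coeff_derivs ws = coeff_derivs vs"
  unfolding foldr_conv_fold
  by (rule fold_multiset_equiv) (auto simp: fun_eq_iff coeff_deriv_commute)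

lemma poly_fun_deg_0:
  fixes c :: "('n::finite \<Rightarrow> nat) \<Rightarrow> real"
  assumes "deg_le 0 c"
  shows "poly_fun m c = (\<lambda>_. c (\<lambda>_. 0))"
proof
  fix x
  have "poly_fun m c x = (\<Sum>\<beta>\<in>{\<lambda>_. 0}. c \<beta> * monom_fun \<beta> x)"
    unfolding poly_fun_def
  proof (intro sum.mono_neutral_right finite_exponents ballI)
    fix \<beta> :: "'n \<Rightarrow> nat" assume "\<beta> \<in> {\<beta>. (\<Sum>i\<in>UNIV. \<beta> i) \<le> m} - {\<lambda>_. 0}"
    then obtain i where "\<beta> i \<noteq> 0" by auto
    then have "0 < (\<Sum>i\<in>UNIV. \<beta> i)" using member_le_sum[of i UNIV \<beta>] by simp
    then have "c \<beta> = 0" using assms unfolding deg_le_def by blast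
    then show "c \<beta> * monom_fun \<beta> x = 0" by simp
  qed simp
  then show "poly_fun m c x = c (\<lambda>_. 0)" by (simp add: monom_fun_def)
qed

lemma coeff_deriv_axis: "coeff_deriv (axis i 1) c \<beta> = real (\<beta> i + 1) * c (\<beta>(i := \<beta> i + 1))"
proof -
  have "coeff_deriv (axis i 1) c \<beta> = (\<Sum>j\<in>UNIV. if j = i then real (\<beta> i + 1) * c (\<beta>(i := \<beta> i + 1)) else 0)"
    unfolding coeff_deriv_def by (intro sum.cong) (auto simp: axis_def)
  then show ?thesis by simp
qed

text \<open>Differentiating along a coordinate axis with positive exponent turns the coefficient
  into one of total degree \<open>j - 1\<close>, multiplied by that exponent, which is not 0. Words
  of axis directions thus reach every coefficient of total degree \<open>j\<close>.\<close>

lemma top_coeffs_zero: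
  assumes "\<And>ws. length ws = j \<Longrightarrow> coeff_derivs ws c (\<lambda>_. 0) = 0" and "(\<Sum>i\<in>UNIV. \<beta> i) = j"
  shows "c \<beta> = 0"
  using assms
proof (induction j arbitrary: c \<beta>)
  case 0
  then have "\<beta> = (\<lambda>_. 0)" by auto
  then show ?case using "0.prems"(1)[of "[]"] by simp
next
  case (Suc j)
  have "\<exists>i. \<beta> i > 0" using Suc.prems(2) by (rule_tac ccontr) simp
  then obtain i where i: "\<beta> i > 0" by blast
  define \<gamma> where "\<gamma> = \<beta>(i := \<beta> i - 1)"
  have "coeff_deriv (axis i 1) c \<gamma> = 0"
  proof (rule Suc.IH)
    fix ws :: "(real^'a) list" assume "length ws = j"
    \<comment> \<open>The axis is appended because the last direction of a list is applied
      first.\<close>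
    then show "coeff_derivs ws (coeff_deriv (axis i 1) c) (\<lambda>_. 0) = 0"
      using Suc.prems(1)[of "ws @ [axis i 1]"] by simp
  next
    show "(\<Sum>i\<in>UNIV. \<gamma> i) = j"
      unfolding \<gamma>_def using sum_fun_upd[of \<beta> i "\<beta> i - 1"] i Suc.prems(2) by linarith
  qed
  then have "real (\<gamma> i + 1) * c (\<gamma>(i := \<gamma> i + 1)) = 0" by (simp only: coeff_deriv_axis)
  moreover have "\<gamma>(i := \<gamma> i + 1) = \<beta>" using i by (auto simp: \<gamma>_def)
  ultimately show ?case by simp
qed

lemma normal_deriv_poly_fun:
  assumes "deg_le m c"
  shows "normal_deriv w k \<alpha> (poly_fun m c) =
    poly_fun m (coeff_derivs (concat (map (\<lambda>i. replicate (\<alpha> i) (w i)) [1..<k+1])) c)"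
proof -
  have deg: "deg_le m (coeff_derivs ws c)" for ws
    using deg_le_coeff_derivs[OF assms] deg_le_mono diff_le_self by blast
  have pow: "(dir_deriv z ^^ a) (poly_fun m (coeff_derivs ws c)) = poly_fun m (coeff_derivs (replicate a z @ ws) c)" for z a ws
  proof (induction a)
    case (Suc a)
    then show ?case using dir_deriv_poly_fun[OF deg, of z "replicate a z @ ws"] by simp
  qed simp
  have "foldr (\<lambda>i. dir_deriv (w i) ^^ \<alpha> i) is (poly_fun m c) =
      poly_fun m (coeff_derivs (concat (map (\<lambda>i. replicate (\<alpha> i) (w i)) is)) c)" for "is"
  proof (induction "is")
    case (Cons i "is")
    show ?case
      unfolding foldr.simps o_apply Cons.IH pow by simp
  qed simp
  then show ?thesis unfolding normal_deriv_def .
qed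

section \<open>Systems of linear equations and faces of simplices\<close>

text \<open>The entries are freed one at a time: \<open>us\<close> is the part still to be reduced,
  with arbitrary entries, and \<open>vs\<close> is the part already taken from \<open>S\<close>.
  Linearity in the last entry of \<open>us\<close> moves it into \<open>S\<close>.\<close>

lemma multilinear_vanish:
  fixes f :: "'a::real_vector list \<Rightarrow> real"
  assumes lin: "\<And>us vs a b w z. f (us @ (a *\<^sub>R w + b *\<^sub>R z) # vs) = a * f (us @ w # vs) + b * f (us @ z # vs)"
    and zero: "\<And>ws. set ws \<subseteq> S \<Longrightarrow> length ws = l \<Longrightarrow> f ws = 0"
    and S: "span S = UNIV" and len: "length ws = l"
  shows "f ws = 0"
proof -
  have "length us + length vs = l \<Longrightarrow> set vs \<subseteq> S \<Longrightarrow> f (us @ vs) = 0" for us vs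
  proof (induction us arbitrary: vs rule: rev_induct)
    case Nil
    then show ?case by (simp add: zero)
  next
    case (snoc w us)
    have "w \<in> span S" using S by simp
    then have "f (us @ w # vs) = 0"
    proof (induction rule: span_induct)
      show "subspace {w. f (us @ w # vs) = 0}"
      proof (rule subspaceI)
        show "0 \<in> {w. f (us @ w # vs) = 0}" using lin[of us 0 0 0 0 vs] by simp
        show "x + y \<in> {w. f (us @ w # vs) = 0}"
          if "x \<in> {w. f (us @ w # vs) = 0}" "y \<in> {w. f (us @ w # vs) = 0}" for x y
          using lin[of us 1 x 1 y vs] that by simp
        show "c *\<^sub>R x \<in> {w. f (us @ w # vs) = 0}" if "x \<in> {w. f (us @ w # vs) = 0}" for c x
          using lin[of us c x 0 0 vs] that by simp
      qed
    next
      fix x assume "x \<in> S"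
      then show "f (us @ x # vs) = 0" using snoc.prems by (intro snoc.IH) auto
    qed
    then show ?case by simp
  qed
  from this[of ws "[]"] len show ?thesis by simp
qed

text \<open>The bridge from words to multi-indices: listing each index of \<open>is\<close> as often
  as it occurs, in the order of \<open>js\<close>, only rearranges \<open>is\<close>.\<close>

lemma mset_concat_replicate:
  assumes "set is \<subseteq> set js" "distinct js"
  shows "mset (concat (map (\<lambda>i. replicate (count_list is i) i) js)) = mset is"
proof -
  have "mset (concat (map (\<lambda>i. replicate (count_list is i) i) js)) =
      (\<Sum>i\<in>set js. replicate_mset (count (mset is) i) i)"
    using assms(2) by (simp add: mset_concat comp_def sum_list_distinct_conv_sum_set count_mset)
  also have "\<dots> = (\<Sum>i\<in>set_mset (mset is). replicate_mset (count (mset is) i) i)"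
    using assms(1) by (intro sum.mono_neutral_right) (auto simp: count_eq_zero_iff)
  also have "\<dots> = mset is"
    by (rule multiset_eqI) (simp add: count_sum count_eq_zero_iff not_in_iff)
  finally show ?thesis .
qed

section \<open>Linear systems over finite index sets\<close>

lemma homogeneous_system_nontrivial:
  fixes a :: "'i \<Rightarrow> 'k \<Rightarrow> real"
  assumes "finite I" "finite K" "card I < card K"
  shows "\<exists>x. (\<exists>k\<in>K. x k \<noteq> 0) \<and> (\<forall>i\<in>I. (\<Sum>k\<in>K. a i k * x k) = 0)"
  using assms
proof (induction I arbitrary: K a rule: finite_induct)
  case empty
  then have "K \<noteq> {}" by auto
  then show ?case by (intro exI[of _ "\<lambda>_. 1"]) auto
next
  case (insert i I)
  show ?case
  proof (cases "\<forall>k\<in>K. a i k = 0")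
    case True
    then show ?thesis using insert.IH[of K a] insert by auto
  next
    case False
    then obtain p where p: "p \<in> K" "a i p \<noteq> 0" by blast
    \<comment> \<open>Gaussian elimination with pivot \<open>a i p\<close>: equation
      \<open>i\<close> expresses the unknown \<open>p\<close> by the others, which are found from
      the remaining equations.\<close>
    have "card I < card (K - {p})" using insert p by simp
    with insert.IH[of "K - {p}" "\<lambda>j k. a j k - a j p * a i k / a i p"] insert.prems obtain x
      where x: "\<exists>k\<in>K - {p}. x k \<noteq> 0" "\<And>j. j \<in> I \<Longrightarrow> (\<Sum>k\<in>K - {p}. (a j k - a j p * a i k / a i p) * x k) = 0"
      by auto
    define s where "s = (\<Sum>k\<in>K - {p}. a i k * x k)"
    define y where "y = x(p := - s / a i p)"
    have sum: "(\<Sum>k\<in>K. a j k * y k) = a j p * (- s / a i p) + (\<Sum>k\<in>K - {p}. a j k * x k)" for j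
    proof -
      have "(\<Sum>k\<in>K. a j k * y k) = a j p * y p + (\<Sum>k\<in>K - {p}. a j k * y k)"
        using insert.prems p by (intro sum.remove) auto
      also have "(\<Sum>k\<in>K - {p}. a j k * y k) = (\<Sum>k\<in>K - {p}. a j k * x k)"
        by (intro sum.cong) (auto simp: y_def)
      finally show ?thesis by (simp add: y_def)
    qed
    have "(\<Sum>k\<in>K. a j k * y k) = 0" if "j \<in> insert i I" for j
    proof (cases "j = i")
      case True
      then show ?thesis using sum[of i] p by (simp add: s_def)
    next
      case False
      then have "j \<in> I" using that by simp
      have "(\<Sum>k\<in>K - {p}. (a j k - a j p * a i k / a i p) * x k) =
          (\<Sum>k\<in>K - {p}. a j k * x k) - (a j p / a i p) * s"
        unfolding s_def by (simp add: left_diff_distrib sum_subtractf sum_distrib_left mult.assoc)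
      then show ?thesis using x(2)[OF \<open>j \<in> I\<close>] sum[of j] by simp
    qed
    moreover have "\<exists>k\<in>K. y k \<noteq> 0" using x(1) by (auto simp: y_def)
    ultimately show ?thesis by blast
  qed
qed

text \<open>The right-hand side becomes the column of an additional unknown \<open>None\<close>, so
  that there are more unknowns than equations. In a nontrivial solution this unknown is not 0, since
  otherwise the rest would lie in the trivial kernel; dividing by it solves the system.\<close>

lemma linear_system_solvable:
  fixes a :: "'i \<Rightarrow> 'k \<Rightarrow> real"
  assumes fin: "finite I" "finite K" "card I \<le> card K"
    and ker: "\<And>x. (\<And>i. i \<in> I \<Longrightarrow> (\<Sum>k\<in>K. a i k * x k) = 0) \<Longrightarrow> \<forall>k\<in>K. x k = 0"
  shows "\<exists>x. \<forall>i\<in>I. (\<Sum>k\<in>K. a i k * x k) = b i"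
proof -
  let ?K = "insert None (Some ` K)"
  have "card I < card ?K" using fin by (simp add: card_image)
  then obtain x where x: "\<exists>k\<in>?K. x k \<noteq> 0"
    "\<And>i. i \<in> I \<Longrightarrow> (\<Sum>k\<in>?K. (case k of None \<Rightarrow> - b i | Some k \<Rightarrow> a i k) * x k) = 0"
    using homogeneous_system_nontrivial[OF fin(1) _ \<open>card I < card ?K\<close>, of "\<lambda>i k. case k of None \<Rightarrow> - b i | Some k \<Rightarrow> a i k"] fin(2)
    by blast
  have eq: "(\<Sum>k\<in>K. a i k * x (Some k)) = b i * x None" if "i \<in> I" for i
    using x(2)[OF that] fin by (simp add: sum.reindex)
  have "x None \<noteq> 0"
  proof
    assume 0: "x None = 0"
    then have "\<forall>k\<in>K. x (Some k) = 0" using eq by (intro ker) simp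
    with 0 x(1) show False by auto
  qed
  then have "(\<Sum>k\<in>K. a i k * (x (Some k) / x None)) = b i" if "i \<in> I" for i
    using eq[OF that] by (simp add: sum_divide_distrib[symmetric])
  then show ?thesis by (intro exI[of _ "\<lambda>k. x (Some k) / x None"] ballI)
qed

section \<open>Faces of a simplex and the directions attached to them\<close>

lemma subsimplices_iff:
  fixes C :: "(real^'n) set"
  assumes C: "\<not> affine_dependent C" "card C = CARD('n) + 1" and k: "k \<le> CARD('n)"
  shows "F \<in> subsimplices (convex hull C) k \<longleftrightarrow>
    (\<exists>S\<subseteq>C. card S = CARD('n) + 1 - k \<and> F = convex hull S)"
proof
  assume F: "F \<in> subsimplices (convex hull C) k"
  then obtain S where S: "S \<subseteq> C" "F = convex hull S"
    using face_of_convex_hull_affine_independent[OF C(1)] by (auto simp: subsimplices_def)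
  have "\<not> affine_dependent S" using C(1) S(1) affine_dependent_subset by blast
  then have "int (card S) - 1 = aff_dim F"
    using aff_dim_affine_independent[of S] S(2) by (simp add: aff_dim_convex_hull)
  also have "\<dots> = int CARD('n) - int k"
    using F by (intro aff_dim_simplex) (simp add: subsimplices_def)
  finally have "card S = CARD('n) + 1 - k" using k by linarith
  with S show "\<exists>S\<subseteq>C. card S = CARD('n) + 1 - k \<and> F = convex hull S" by blast
next
  assume "\<exists>S\<subseteq>C. card S = CARD('n) + 1 - k \<and> F = convex hull S"
  then obtain S where S: "S \<subseteq> C" "card S = CARD('n) + 1 - k" "F = convex hull S" by blast
  have "\<not> affine_dependent S" using C(1) S(1) affine_dependent_subset by blast
  then have "(int CARD('n) - int k) simplex F"
    unfolding S(3) using S(2) k by (intro simplex_convex_hull conjI) auto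
  moreover have "F face_of convex hull C"
    using face_of_convex_hull_affine_independent[OF C(1)] S by blast
  ultimately show "F \<in> subsimplices (convex hull C) k" by (simp add: subsimplices_def)
qed

lemma card_subsimplices_le:
  fixes C :: "(real^'n) set"
  assumes C: "\<not> affine_dependent C" "card C = CARD('n) + 1" and k: "k \<le> CARD('n)"
  shows "finite (subsimplices (convex hull C) k)"
    and "card (subsimplices (convex hull C) k) \<le> (CARD('n) + 1) choose k"
proof -
  let ?A = "{S. S \<subseteq> C \<and> card S = CARD('n) + 1 - k}"
  have "finite C" using C(1) by (rule aff_independent_finite)
  then have fin: "finite ?A" by simp
  have eq: "subsimplices (convex hull C) k = (\<lambda>S. convex hull S) ` ?A"
    using subsimplices_iff[OF C k] by blast
  show "finite (subsimplices (convex hull C) k)" unfolding eq using fin by simp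
  have "card (subsimplices (convex hull C) k) \<le> card ?A" unfolding eq using fin by (rule card_image_le)
  also have "\<dots> = (CARD('n) + 1) choose (CARD('n) + 1 - k)"
    using n_subsets[OF \<open>finite C\<close>] C(2) by simp
  also have "\<dots> = (CARD('n) + 1) choose k" using k by (intro binomial_symmetric[symmetric]) simp
  finally show "card (subsimplices (convex hull C) k) \<le> (CARD('n) + 1) choose k" .
qed

text \<open>The edges span the tangent space, of dimension \<open>n - k\<close>. Its orthogonal
  complement has dimension \<open>k\<close>, so the \<open>k\<close> independent normals fill
  it.\<close>

lemma span_normals_edges:
  fixes S :: "(real^'n) set" and w :: "nat \<Rightarrow> real^'n"
  assumes S: "\<not> affine_dependent S" "card S = CARD('n) + 1 - k" and k: "k \<le> CARD('n)"
    and w: "inj_on w {1..k}" "independent (w ` {1..k})"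
      "\<And>i z. i \<in> {1..k} \<Longrightarrow> z \<in> tangent_space (convex hull S) \<Longrightarrow> orthogonal (w i) z"
  shows "span (w ` {1..k} \<union> {b - a | a b. a \<in> S \<and> b \<in> S \<and> a \<noteq> b}) = UNIV"
proof -
  let ?V = "tangent_space (convex hull S)"
  let ?E = "{b - a | a b. a \<in> S \<and> b \<in> S \<and> a \<noteq> b}"
  let ?W = "{y \<in> UNIV. \<forall>x\<in>?V. orthogonal x y}"
  have "S \<noteq> {}" using S(2) k by auto
  then obtain p where p: "p \<in> S" by blast
  have V: "?V = span ((\<lambda>x. x - p) ` S)" by (rule tangent_space_convex_hull[OF p])
  have sub: "subspace ?V" unfolding V by simp
  have "int (dim ?V) = aff_dim S"
    unfolding V dim_span using p by (subst aff_dim_eq_dim_subtract[of p]) (auto intro: hull_inc)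
  then have dimV: "dim ?V = CARD('n) - k"
    using aff_dim_affine_independent[OF S(1)] S(2) k by simp
  have VE: "?V \<subseteq> span ?E"
    unfolding V
  proof (rule span_minimal)
    show "(\<lambda>x. x - p) ` S \<subseteq> span ?E"
    proof clarify
      fix x assume "x \<in> S"
      then show "x - p \<in> span ?E" using p by (cases "x = p") (auto intro: span_base simp: span_zero)
    qed
  qed simp
  have "dim ?W + dim ?V = dim (UNIV :: (real^'n) set)"
    by (rule dim_subspace_orthogonal_to_vectors[OF sub subspace_UNIV]) simp
  then have dimW: "dim ?W = k" using dimV k by simp
  have NW: "w ` {1..k} \<subseteq> ?W" using w(3) by (auto simp: orthogonal_commute)
  have "card (w ` {1..k}) = k" using w(1) by (simp add: card_image)
  then have WN: "?W \<subseteq> span (w ` {1..k})"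
    using card_eq_dim[OF NW, of] w(2) dimW by simp
  have "x \<in> span (w ` {1..k} \<union> ?E)" for x :: "real^'n"
  proof -
    obtain y z where yz: "y \<in> span ?V" "\<And>u. u \<in> span ?V \<Longrightarrow> orthogonal z u" "x = y + z"
      using orthogonal_subspace_decomp_exists[of ?V x] by blast
    have "y \<in> span ?E" using yz(1) VE span_minimal[OF VE] by blast
    moreover have "z \<in> ?W" using yz(2) span_base[of _ ?V] by (auto simp: orthogonal_commute)
    then have "z \<in> span (w ` {1..k})" using WN by blast
    ultimately show ?thesis
      unfolding yz(3) using span_mono[of ?E "w ` {1..k} \<union> ?E"] span_mono[of "w ` {1..k}" "w ` {1..k} \<union> ?E"]
      by (intro span_add) auto
  qed
  then show ?thesis by blast
qed

lemma d_face_eq: "d_face \<nu> k F \<alpha> v = face_avg F (normal_deriv (\<nu> F) k \<alpha> v)"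
  by (simp add: d_face_def face_avg_def)

text \<open>The order \<open>M - k\<close> is tuned to the edge identity: integrating out one edge
  direction lowers the order by one and raises the codimension by one. Multilinearity reduces the
  claim to words in normals and edges. A word with an edge reduces to two facets of
  \<open>F\<close>, and a word of normals alone is, after sorting, a degree of freedom.\<close>

lemma face_avg_derivs_zero:
  fixes C :: "(real^'n) set"
  assumes C: "\<not> affine_dependent C" "card C = CARD('n) + 1"
    and \<nu>: "normal_frames (convex hull C) \<nu>"
    and c: "deg_le m c" and M: "M \<ge> 1"
    and H: "\<And>k F \<alpha>. 1 \<le> k \<Longrightarrow> k \<le> CARD('n) \<Longrightarrow> k \<le> M \<Longrightarrow> F \<in> subsimplices (convex hull C) k \<Longrightarrow>
      \<alpha> \<in> A_set CARD('n) k \<Longrightarrow> (\<Sum>i = 1..CARD('n). \<alpha> i) = M - k \<Longrightarrow> d_face \<nu> k F \<alpha> (poly_fun m c) = 0"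
    and k: "k \<le> CARD('n)" "k \<le> M" and F: "F \<in> subsimplices (convex hull C) k" and ws: "length ws = M - k"
  shows "face_avg F (poly_fun m (coeff_derivs ws c)) = 0"
  using k F ws
proof (induction "CARD('n) - k" arbitrary: k F ws rule: less_induct)
  case less
  obtain S where S: "S \<subseteq> C" "card S = CARD('n) + 1 - k" "F = convex hull S"
    using less.prems subsimplices_iff[OF C] by blast
  have indS: "\<not> affine_dependent S" using C(1) S(1) affine_dependent_subset by blast
  have finS: "finite S" using indS by (rule aff_independent_finite)
  have F: "F \<noteq> {}" "compact F" "convex F"
    using S less.prems(1) finS by (auto simp: finite_imp_compact_convex_hull)
  have deg: "deg_le m (coeff_derivs ws c)" for ws
    using deg_le_coeff_derivs[OF c] deg_le_mono diff_le_self by blast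
  let ?N = "\<nu> F ` {1..k}" and ?E = "{b - a | a b. a \<in> S \<and> b \<in> S \<and> a \<noteq> b}"
  have frame: "inj_on (\<nu> F) {1..k}" "independent (\<nu> F ` {1..k})"
      "\<And>i z. i \<in> {1..k} \<Longrightarrow> z \<in> tangent_space (convex hull S) \<Longrightarrow> orthogonal (\<nu> F i) z"
  proof -
    have "inj_on (\<nu> F) {1..k} \<and> independent (\<nu> F ` {1..k}) \<and>
      (\<forall>i\<in>{1..k}. \<forall>z\<in>tangent_space (convex hull S). orthogonal (\<nu> F i) z)"
    \<comment> \<open>\<open>normal_frames\<close> speaks of positive codimension only; in
      codimension 0 the frame is empty.\<close>
    proof (cases "k = 0")
      case False
      then have "k \<in> {1..CARD('n)}" using less.prems(1) by simp
      then show ?thesis using \<nu> less.prems(3) S(3) unfolding normal_frames_def by blast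
    qed (simp add: independent_empty)
    then show "inj_on (\<nu> F) {1..k}" "independent (\<nu> F ` {1..k})"
      "\<And>i z. i \<in> {1..k} \<Longrightarrow> z \<in> tangent_space (convex hull S) \<Longrightarrow> orthogonal (\<nu> F i) z" by blast+
  qed
  have span: "span (?N \<union> ?E) = UNIV"
    using span_normals_edges[OF indS S(2) less.prems(1) frame] .
  show ?case
  proof (rule multilinear_vanish[where f = "\<lambda>ws. face_avg F (poly_fun m (coeff_derivs ws c))", OF _ _ span less.prems(4)])
    fix us vs a b w z
    show "face_avg F (poly_fun m (coeff_derivs (us @ (a *\<^sub>R w + b *\<^sub>R z) # vs) c)) =
       a * face_avg F (poly_fun m (coeff_derivs (us @ w # vs) c)) + b * face_avg F (poly_fun m (coeff_derivs (us @ z # vs) c))"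
      by (simp add: coeff_deriv_linear_dir coeff_derivs_linear poly_fun_linear face_avg_linear[OF F(1,2) continuous_poly_fun continuous_poly_fun])
  next
    fix ws assume ws: "set ws \<subseteq> ?N \<union> ?E" "length ws = M - k"
    show "face_avg F (poly_fun m (coeff_derivs ws c)) = 0"
    proof (cases "set ws \<subseteq> ?N")
      case False
      then obtain w where w: "w \<in> set ws" "w \<in> ?E" using ws(1) by blast
      then obtain a b where ab: "w = b - a" "a \<in> S" "b \<in> S" "a \<noteq> b" by blast
      define r where "r = remove1 w ws"
      have "mset ws = mset (w # r)" using w(1) by (simp add: r_def)
      then have eq: "coeff_derivs ws = coeff_derivs (w # r)" by (rule coeff_derivs_mset)
      have len: "length r = M - (k + 1)" using w(1) ws(2) by (simp add: r_def length_remove1)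
      have kM: "k + 1 \<le> M" using w(1) ws(2) less.prems(2) by (cases "M = k") auto
      \<comment> \<open>A face with an edge has two vertices, so its facets still have codimension
        at most \<open>n\<close>.\<close>
      have "card {a, b} \<le> card S" using ab finS by (intro card_mono) auto
      then have kn: "k + 1 \<le> CARD('n)" using S(2) ab(4) by simp
      have sub: "convex hull (S - {p}) \<in> subsimplices (convex hull C) (k + 1)" if "p \<in> S" for p
        using S that finS by (subst subsimplices_iff[OF C kn]) (auto intro!: exI[of _ "S - {p}"])
      have IH: "face_avg (convex hull (S - {p})) (poly_fun m (coeff_derivs r c)) = 0" if "p \<in> S" for p
        using less.hyps[OF _ kn kM sub[OF that] len] kn by simp
      have "face_avg (convex hull S) (\<lambda>x. poly_fun m (coeff_deriv (b - a) (coeff_derivs r c)) x) = 0"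
        using face_avg_edge_derivative[OF indS ab(2-4) has_derivative_poly_fun[OF deg[of r]] continuous_poly_fun] IH ab
        by simp
      then show ?thesis unfolding eq S(3) ab(1) by simp
    next
      case True
      \<comment> \<open>In codimension 0 there are no normals, while the word has
        \<open>M \<ge> 1\<close> letters.\<close>
      have k1: "k \<ge> 1"
      proof (rule ccontr)
        assume "\<not> 1 \<le> k"
        then show False using True ws(2) M by auto
      qed
      have "ws \<in> map (\<nu> F) ` lists {1..k}" using True by (subst lists_image[symmetric]) (simp add: lists_eq_set)
      then obtain "is" where "is": "set is \<subseteq> {1..k}" "ws = map (\<nu> F) is" by (auto simp: lists_eq_set)
      define \<alpha> where "\<alpha> = count_list is"
      have \<alpha>0: "\<alpha> i = 0" if "i \<notin> {1..k}" for i
        using "is"(1) that unfolding \<alpha>_def by (intro count_notin) auto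
      have \<alpha>: "\<alpha> \<in> A_set CARD('n) k"
        using \<alpha>0 less.prems(1) by (auto simp: A_set_def multi_indices_def)
      have "(\<Sum>i = 1..CARD('n). \<alpha> i) = length is"
        unfolding \<alpha>_def using "is"(1) less.prems(1) by (intro sum_count_set) auto
      then have sum: "(\<Sum>i = 1..CARD('n). \<alpha> i) = M - k" using ws(2) "is"(2) by simp
      have "mset (concat (map (\<lambda>i. replicate (\<alpha> i) (\<nu> F i)) [1..<k+1])) =
          image_mset (\<nu> F) (mset (concat (map (\<lambda>i. replicate (\<alpha> i) i) [1..<k+1])))"
        by (simp add: mset_map[symmetric] map_concat comp_def del: mset_map)
      also have "mset (concat (map (\<lambda>i. replicate (\<alpha> i) i) [1..<k+1])) = mset is"
        unfolding \<alpha>_def using "is"(1) by (intro mset_concat_replicate) auto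
      finally have "coeff_derivs (concat (map (\<lambda>i. replicate (\<alpha> i) (\<nu> F i)) [1..<k+1])) = coeff_derivs ws"
        unfolding "is"(2) by (intro coeff_derivs_mset) simp
      then show ?thesis
        using H[OF k1 less.prems(1,2,3) \<alpha> sum] by (simp add: d_face_eq normal_deriv_poly_fun[OF c] del: upt_Suc)
    qed
  qed
qed

section \<open>Unisolvence\<close>

lemma level_count:
  assumes "M \<ge> 1"
  shows "(\<Sum>k = 1..min n M. ((n + 1) choose k) * ((M - 1) choose (M - k))) +
    (if n + 1 \<le> M then (M - 1) choose (M - (n + 1)) else 0) \<le> (n + M) choose M"
proof -
  let ?f = "\<lambda>k. ((n + 1) choose k) * ((M - 1) choose (M - k))"
  \<comment> \<open>For \<open>M < n + 1\<close> the difference \<open>M - (n + 1)\<close> would be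
    truncated to 0 and its binomial coefficient would be 1, hence the case distinction.\<close>
  let ?X = "if n + 1 \<le> M then {n + 1} else {}"
  have "(\<Sum>k = 1..min n M. ?f k) + (if n + 1 \<le> M then (M - 1) choose (M - (n + 1)) else 0) =
      (\<Sum>k = 1..min n M. ?f k) + (\<Sum>k\<in>?X. ?f k)" by simp
  also have "\<dots> = (\<Sum>k\<in>{1..min n M} \<union> ?X. ?f k)" by (intro sum.union_disjoint[symmetric]) auto
  also have "\<dots> \<le> (\<Sum>k\<le>M. ?f k)" by (intro sum_mono2) auto
  also have "\<dots> = (n + 1 + (M - 1)) choose M" by (rule vandermonde)
  also have "n + 1 + (M - 1) = n + M" using assms by simp
  finally show ?thesis .
qed

text \<open>A nonnegative level, indexed by \<open>M = m - (n + 1) (L - l)\<close> instead of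
  \<open>l\<close>. The compositions over \<open>{1..k}\<close> are the multi-indices of
  \<open>A_set\<close> with total \<open>M - k\<close>. For \<open>M = 0\<close> the range of
  \<open>k\<close> is empty.\<close>

definition face_level :: "(real^'n) set \<Rightarrow> ((real^'n) set \<Rightarrow> nat \<Rightarrow> real^'n) \<Rightarrow> nat \<Rightarrow> ((real^'n \<Rightarrow> real) \<Rightarrow> real) set" where
  "face_level T \<nu> M = (\<Union>k\<in>{1..min CARD('n) M}.
     (\<lambda>(F, \<alpha>). d_face \<nu> k F \<alpha>) ` (subsimplices T k \<times> weak_compositions {1..k} (M - k)))"

lemma card_face_level_le:
  fixes C :: "(real^'n) set"
  assumes C: "\<not> affine_dependent C" "card C = CARD('n) + 1"
  shows "finite (face_level (convex hull C) \<nu> M)"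
    and "card (face_level (convex hull C) \<nu> M) \<le>
      (\<Sum>k = 1..min CARD('n) M. ((CARD('n) + 1) choose k) * ((M - 1) choose (M - k)))"
proof -
  have weak_compositions: "finite (weak_compositions {1..k} (M - k))" "card (weak_compositions {1..k} (M - k)) = (M - 1) choose (M - k)"
    if "k \<in> {1..min CARD('n) M}" for k
  proof -
    obtain r where "k = Suc r" using \<open>k \<in> _\<close> by (cases k) auto
    then show "finite (weak_compositions {1..k} (M - k))" "card (weak_compositions {1..k} (M - k)) = (M - 1) choose (M - k)"
      using card_weak_compositions[of "{1..k}" r "M - k"] that by auto
  qed
  have fin: "finite (subsimplices (convex hull C) k \<times> weak_compositions {1..k} (M - k))" if "k \<in> {1..min CARD('n) M}" for k
    using card_subsimplices_le(1)[OF C, of k] weak_compositions(1)[OF that] that by auto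
  then show "finite (face_level (convex hull C) \<nu> M)" unfolding face_level_def by blast
  have "card (face_level (convex hull C) \<nu> M) \<le> (\<Sum>k = 1..min CARD('n) M.
     card ((\<lambda>(F, \<alpha>). d_face \<nu> k F \<alpha>) ` (subsimplices (convex hull C) k \<times> weak_compositions {1..k} (M - k))))"
    unfolding face_level_def by (rule card_UN_le) simp
  also have "\<dots> \<le> (\<Sum>k = 1..min CARD('n) M. ((CARD('n) + 1) choose k) * ((M - 1) choose (M - k)))"
  proof (rule sum_mono)
    fix k assume k: "k \<in> {1..min CARD('n) M}"
    have "card ((\<lambda>(F, \<alpha>). d_face \<nu> k F \<alpha>) ` (subsimplices (convex hull C) k \<times> weak_compositions {1..k} (M - k))) \<le>
        card (subsimplices (convex hull C) k \<times> weak_compositions {1..k} (M - k))"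
      using fin[OF k] by (rule card_image_le)
    also have "\<dots> \<le> ((CARD('n) + 1) choose k) * ((M - 1) choose (M - k))"
      unfolding card_cartesian_product weak_compositions(2)[OF k]
      using card_subsimplices_le(2)[OF C, of k] k by (intro mult_right_mono) auto
    finally show "card ((\<lambda>(F, \<alpha>). d_face \<nu> k F \<alpha>) ` (subsimplices (convex hull C) k \<times> weak_compositions {1..k} (M - k)))
      \<le> ((CARD('n) + 1) choose k) * ((M - 1) choose (M - k))" .
  qed
  finally show "card (face_level (convex hull C) \<nu> M) \<le>
      (\<Sum>k = 1..min CARD('n) M. ((CARD('n) + 1) choose k) * ((M - 1) choose (M - k)))" .
qed

text \<open>Induction over the parameters congruent to \<open>r\<close>: the term that
  \<open>level_count\<close> sets aside for \<open>M\<close> is exactly the bound for the preceding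
  parameter. At the start with \<open>r = 0\<close> there are no face functionals, and
  \<open>d_zero\<close> alone accounts for the dimension 1 of the constants.\<close>

lemma card_levels_le:
  fixes C :: "(real^'n) set"
  assumes C: "\<not> affine_dependent C" "card C = CARD('n) + 1" and r: "r < CARD('n) + 1"
  shows "finite ((if r = 0 then {d_zero (convex hull C)} else {}) \<union>
      (\<Union>l\<le>q. face_level (convex hull C) \<nu> (r + (CARD('n) + 1) * l)))" (is "finite (?U q)")
    and "card ((if r = 0 then {d_zero (convex hull C)} else {}) \<union>
      (\<Union>l\<le>q. face_level (convex hull C) \<nu> (r + (CARD('n) + 1) * l)))
    \<le> (CARD('n) + (r + (CARD('n) + 1) * q)) choose (r + (CARD('n) + 1) * q)"
proof -
  show fin: "finite (?U q)" for q using card_face_level_le(1)[OF C] by simp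
  show "card (?U q) \<le> (CARD('n) + (r + (CARD('n) + 1) * q)) choose (r + (CARD('n) + 1) * q)"
  proof (induction q)
    case 0
    show ?case
    proof (cases "r = 0")
      case True
      then show ?thesis by (simp add: face_level_def)
    next
      case False
      have "card (face_level (convex hull C) \<nu> r) \<le> (CARD('n) + r) choose r"
        using card_face_level_le(2)[OF C, of \<nu> r] level_count[of r "CARD('n)"] False by linarith
      then show ?thesis using False by simp
    qed
  next
    case (Suc q)
    define M where "M = r + (CARD('n) + 1) * Suc q"
    have M: "M \<ge> CARD('n) + 1" "M - (CARD('n) + 1) = r + (CARD('n) + 1) * q"
      "M - 1 = CARD('n) + (r + (CARD('n) + 1) * q)" by (simp_all add: M_def)
    have "?U (Suc q) = face_level (convex hull C) \<nu> M \<union> ?U q"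
      unfolding M_def by (simp only: atMost_Suc UN_insert Un_left_commute)
    then have "card (?U (Suc q)) \<le> card (face_level (convex hull C) \<nu> M) + card (?U q)"
      by (simp only: card_Un_le)
    also have "\<dots> \<le> (\<Sum>k = 1..min CARD('n) M. ((CARD('n) + 1) choose k) * ((M - 1) choose (M - k))) +
        (if CARD('n) + 1 \<le> M then (M - 1) choose (M - (CARD('n) + 1)) else 0)"
      using card_face_level_le(2)[OF C, of \<nu> M] Suc.IH M by (intro add_mono) simp_all
    also have "\<dots> \<le> (CARD('n) + M) choose M"
      using M(1) by (intro level_count) simp
    finally show ?case unfolding M_def .
  qed
qed

text \<open>Passage from integer levels to natural numbers. With \<open>m = (n + 1) L + r\<close>
  the parameter of level \<open>l\<close> is \<open>r + (n + 1) l\<close>, which involves no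
  subtraction.\<close>

lemma DOF_subset:
  fixes T :: "(real^'n) set"
  shows "DOF T \<nu> m \<subseteq> (if m mod (CARD('n) + 1) = 0 then {d_zero T} else {}) \<union>
      (\<Union>l\<le>m div (CARD('n) + 1). face_level T \<nu> (m mod (CARD('n) + 1) + (CARD('n) + 1) * l))"
proof
  let ?n = "CARD('n)"
  let ?L = "m div (?n + 1)"
  fix d assume "d \<in> DOF T \<nu> m"
  then obtain l where l: "l \<in> {-1..int ?L}" "d \<in> DOF_level T \<nu> m l" unfolding DOF_def by blast
  show "d \<in> (if m mod (?n + 1) = 0 then {d_zero T} else {}) \<union>
      (\<Union>l\<le>?L. face_level T \<nu> (m mod (?n + 1) + (?n + 1) * l))"
  proof (cases "l = -1")
    case True
    with l(2) show ?thesis by (auto simp: DOF_level_def Let_def split: if_splits)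
  next
    case False
    define l' where "l' = nat l"
    have l': "l = int l'" "l' \<le> ?L" using l(1) False by (auto simp: l'_def)
    define M where "M = m mod (?n + 1) + (?n + 1) * l'"
    have "int m = int ((?n + 1) * ?L + m mod (?n + 1))" by (simp only: mult_div_mod_eq)
    then have M: "int m - (int ?n + 1) * (int ?L - l) = int M"
      unfolding M_def l'(1) by (simp add: algebra_simps)
    obtain k F \<alpha> where kF: "d = d_face \<nu> k F \<alpha>" "1 \<le> k" "int k \<le> min (int ?n) (int M)"
      "F \<in> subsimplices T k" "\<alpha> \<in> A_set ?n k" "int (\<Sum>i = 1..?n. \<alpha> i) = int m - int k - (int ?n + 1) * (int ?L - l)"
      using l(2) False unfolding DOF_level_def Let_def M[symmetric] by auto
    have sum: "(\<Sum>i = 1..?n. \<alpha> i) = M - k" using kF(3,6) M by linarith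
    have "\<alpha> i = 0" if "i \<notin> {1..k}" for i
      using kF(5) that unfolding A_set_def multi_indices_def by (cases "i \<in> {1..?n}") auto
    moreover from this have "(\<Sum>i = 1..k. \<alpha> i) = (\<Sum>i = 1..?n. \<alpha> i)"
      using kF(3) by (intro sum.mono_neutral_left) auto
    ultimately have "\<alpha> \<in> weak_compositions {1..k} (M - k)" using sum by (auto simp: weak_compositions_def)
    moreover have "k \<in> {1..min ?n M}" using kF(2,3) by simp
    ultimately have "d \<in> face_level T \<nu> M" unfolding face_level_def kF(1) using kF(4) by force
    then show ?thesis using l'(2) unfolding M_def by blast
  qed
qed

lemma d_zero_const:
  fixes T :: "(real^'n) set"
  assumes "int CARD('n) simplex T"
  shows "d_zero T (\<lambda>_. a) = a"
proof -
  have cpt: "compact T" and cvx: "convex T" using assms by (auto simp: compact_simplex convex_simplex)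
  have "T \<noteq> {}" using assms by auto
  then have "interior T \<noteq> {}"
    using aff_dim_simplex[OF assms] rel_interior_eq_empty[OF cvx] by (subst interior_rel_interior_gen) simp
  then have "\<not> negligible T" using negligible_convex_interior[OF cvx] by simp
  then have "measure lebesgue T \<noteq> 0" using lmeasurable_compact[OF cpt] by (simp add: negligible_iff_measure)
  moreover have "T \<in> sets lborel" using borel_compact[OF cpt] by simp
  ultimately have "measure lborel T \<noteq> 0" by simp
  then show ?thesis unfolding d_zero_def set_lebesgue_integral_def
    using \<open>T \<in> sets lborel\<close> by simp
qed

lemma DOF_linear:
  fixes C :: "(real^'n) set"
  assumes C: "\<not> affine_dependent C" "card C = CARD('n) + 1" and d: "d \<in> DOF (convex hull C) \<nu> m"
    and c: "deg_le m c" "deg_le m e"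
  shows "d (poly_fun m (\<lambda>\<beta>. a * c \<beta> + b * e \<beta>)) = a * d (poly_fun m c) + b * d (poly_fun m e)"
proof -
  have deg: "deg_le m (\<lambda>\<beta>. a * c \<beta> + b * e \<beta>)" using c by (simp add: deg_le_def)
  have "d = d_zero (convex hull C) \<or> (\<exists>k F \<alpha>. k \<le> CARD('n) \<and> F \<in> subsimplices (convex hull C) k \<and> d = d_face \<nu> k F \<alpha>)"
    using subsetD[OF DOF_subset d]
  proof (elim UnE UN_E)
    assume "d \<in> (if m mod (CARD('n) + 1) = 0 then {d_zero (convex hull C)} else {})"
    then show ?thesis by (auto split: if_splits)
  next
    fix l assume "d \<in> face_level (convex hull C) \<nu> (m mod (CARD('n) + 1) + (CARD('n) + 1) * l)"
    then show ?thesis unfolding face_level_def by fastforce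
  qed
  then show ?thesis
  proof (elim disjE exE conjE)
    assume d: "d = d_zero (convex hull C)"
    have "compact (convex hull C)" using aff_independent_finite[OF C(1)] by (rule finite_imp_compact_convex_hull)
    then have "integrable lborel (\<lambda>x. indicator (convex hull C) x *\<^sub>R poly_fun m c x)" for c
      using borel_integrable_compact[OF _ continuous_poly_fun] by (simp add: indicator_def if_distrib cong: if_cong)
    then show ?thesis
      unfolding d d_zero_def set_lebesgue_integral_def poly_fun_linear
      by (simp add: algebra_simps)
  next
    fix k F \<alpha> assume k: "k \<le> CARD('n)" and F: "F \<in> subsimplices (convex hull C) k" and d: "d = d_face \<nu> k F \<alpha>"
    obtain S where S: "S \<subseteq> C" "card S = CARD('n) + 1 - k" "F = convex hull S"
      using subsimplices_iff[OF C k] F by blast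
    have "F \<noteq> {}" "compact F"
      using S k finite_subset[OF S(1) aff_independent_finite[OF C(1)]] by (auto simp: finite_imp_compact_convex_hull)
    then show ?thesis
      unfolding d d_face_eq normal_deriv_poly_fun[OF c(1)] normal_deriv_poly_fun[OF c(2)] normal_deriv_poly_fun[OF deg]
      unfolding coeff_derivs_linear poly_fun_linear
      by (intro face_avg_linear continuous_poly_fun)
  qed
qed

text \<open>In degree \<open>j\<close> the coefficients are annihilated at codimension \<open>k\<close> and level \<open>L - q\<close>, where
  \<open>m - j = (n + 1) q + k\<close> is division with remainder: there the averaged derivatives of order \<open>j\<close>
  of a polynomial of degree at most \<open>j\<close> are constants.\<close>

lemma DOF_kernel_top:
  fixes C :: "(real^'n) set"
  assumes C: "\<not> affine_dependent C" "card C = CARD('n) + 1"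
    and \<nu>: "normal_frames (convex hull C) \<nu>"
    and zero: "\<forall>d\<in>DOF (convex hull C) \<nu> m. d (poly_fun m c) = 0"
    and c: "deg_le j c" and j: "j \<le> m" and \<beta>: "(\<Sum>i\<in>UNIV. \<beta> i) = j"
  shows "c \<beta> = 0"
proof -
  let ?n = "CARD('n)" and ?T = "convex hull C"
  define q where "q = (m - j) div (?n + 1)"
  define k where "k = (m - j) mod (?n + 1)"
  define M where "M = j + k"
  have "m - j = (?n + 1) * q + k" unfolding q_def k_def by (simp only: mult_div_mod_eq)
  then have m: "m = M + (?n + 1) * q" using j by (simp add: M_def)
  have "k < ?n + 1" unfolding k_def by (rule mod_less_divisor) simp
  then have k: "k \<le> ?n" "k \<le> M" by (simp_all add: M_def)
  have cm: "deg_le m c" using c j by (rule deg_le_mono)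
  have T: "int ?n simplex ?T" using C by (intro simplex_convex_hull) simp
  show ?thesis
  \<comment> \<open>\<open>M = 0\<close> forces \<open>j = 0\<close> and \<open>m\<close> divisible
    by \<open>n + 1\<close>: the constant term at the bottom of the descent, which only
    \<open>d_zero\<close> controls.\<close>
  proof (cases "M = 0")
    case True
    then have "m mod (?n + 1) = 0" unfolding m by (simp only: add_0 mod_mult_self1_is_0)
    have "j = 0" using True by (simp add: M_def)
    have "d_zero ?T \<in> DOF ?T \<nu> m"
      using \<open>m mod (?n + 1) = 0\<close> unfolding DOF_def by (intro UN_I[of "-1"]) (auto simp: DOF_level_def Let_def)
    from bspec[OF zero this] have "c (\<lambda>_. 0) = 0"
      using poly_fun_deg_0[of c m] c \<open>j = 0\<close> d_zero_const[OF T] by simp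
    moreover have "\<beta> = (\<lambda>_. 0)" using \<beta> \<open>j = 0\<close> by auto
    ultimately show ?thesis by simp
  next
    case False
    have H: "d_face \<nu> k F \<alpha> (poly_fun m c) = 0"
      if "1 \<le> k" "k \<le> ?n" "k \<le> M" "F \<in> subsimplices ?T k" "\<alpha> \<in> A_set ?n k" "(\<Sum>i = 1..?n. \<alpha> i) = M - k" for k F \<alpha>
    proof (rule bspec[OF zero])
      have qL: "q \<le> m div (?n + 1)" unfolding q_def by (rule div_le_mono) simp
      have M: "int m - (int ?n + 1) * (int (m div (?n + 1)) - (int (m div (?n + 1)) - int q)) = int M"
        unfolding m by (simp add: algebra_simps)
      have "int k \<le> min (int ?n) (int m - (int ?n + 1) * (int (m div (?n + 1)) - (int (m div (?n + 1)) - int q)))"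
        unfolding M using that by simp
      moreover have "int (\<Sum>i = 1..?n. \<alpha> i) =
          int m - int k - (int ?n + 1) * (int (m div (?n + 1)) - (int (m div (?n + 1)) - int q))"
        using M that(3,6) by linarith
      moreover have "int (m div (?n + 1)) - int q \<noteq> - 1" using qL by simp
      ultimately have "d_face \<nu> k F \<alpha> \<in> DOF_level ?T \<nu> m (int (m div (?n + 1)) - int q)"
        unfolding DOF_level_def Let_def using that(1,4,5) by (simp only: if_False) blast
      then show "d_face \<nu> k F \<alpha> \<in> DOF ?T \<nu> m" unfolding DOF_def using qL by fastforce
    qed
    \<comment> \<open>One face of codimension \<open>k\<close> is enough, since the average of a
      constant over it is that constant.\<close>
    have "\<exists>S\<subseteq>C. card S = ?n + 1 - k"
      using obtain_subset_with_card_n[of "?n + 1 - k" C] C(2) by (metis diff_le_self)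
    then obtain S where S: "S \<subseteq> C" "card S = ?n + 1 - k" by blast
    then have F: "convex hull S \<in> subsimplices ?T k" using subsimplices_iff[OF C k(1)] by blast
    have F': "convex hull S \<noteq> {}" "compact (convex hull S)" "convex (convex hull S)"
      using S k finite_subset[OF S(1) aff_independent_finite[OF C(1)]] by (auto simp: finite_imp_compact_convex_hull)
    have "coeff_derivs ws c (\<lambda>_. 0) = 0" if ws: "length ws = j" for ws
    proof -
      have "deg_le 0 (coeff_derivs ws c)" using deg_le_coeff_derivs[OF c, of ws] ws by simp
      from poly_fun_deg_0[OF this, of m] have "face_avg (convex hull S) (poly_fun m (coeff_derivs ws c)) = coeff_derivs ws c (\<lambda>_. 0)"
        using face_avg_const[OF F'] by simp
      moreover have "face_avg (convex hull S) (poly_fun m (coeff_derivs ws c)) = 0"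
        using face_avg_derivs_zero[OF C \<nu> cm _ H k F] ws False by (simp add: M_def Suc_le_eq)
      ultimately show ?thesis by simp
    qed
    then show ?thesis using \<beta> by (rule top_coeffs_zero)
  qed
qed

lemma DOF_kernel_trivial:
  fixes C :: "(real^'n) set"
  assumes C: "\<not> affine_dependent C" "card C = CARD('n) + 1"
    and \<nu>: "normal_frames (convex hull C) \<nu>"
    and zero: "\<forall>d\<in>DOF (convex hull C) \<nu> m. d (poly_fun m c) = 0"
    and c: "deg_le m c"
  shows "c \<beta> = 0"
proof -
  have "deg_le j c \<Longrightarrow> j \<le> m \<Longrightarrow> c \<beta> = 0" for j
  proof (induction j)
    case 0
    show ?case
    proof (cases "(\<Sum>i\<in>UNIV. \<beta> i) = 0")
      case True
      then show ?thesis by (rule DOF_kernel_top[OF C \<nu> zero "0.prems"])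
    next
      case False
      then have "0 < (\<Sum>i\<in>UNIV. \<beta> i)" by (simp only: neq0_conv)
      then show ?thesis using "0.prems"(1) unfolding deg_le_def by blast
    qed
  next
    case (Suc j)
    have "c \<gamma> = 0" if "j < (\<Sum>i\<in>UNIV. \<gamma> i)" for \<gamma>
    proof (cases "(\<Sum>i\<in>UNIV. \<gamma> i) = Suc j")
      case True
      then show ?thesis by (rule DOF_kernel_top[OF C \<nu> zero Suc.prems])
    next
      case False
      then have "Suc j < (\<Sum>i\<in>UNIV. \<gamma> i)" using that by simp
      then show ?thesis using Suc.prems(1) unfolding deg_le_def by blast
    qed
    then have "deg_le j c" unfolding deg_le_def by blast
    then show ?case using Suc.IH Suc.prems(2) by simp
  qed
  from this[OF c] show ?thesis by simp
qed

theorem theorem2p5: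
  fixes T :: "(real^'n) set"
    and \<nu> :: "(real^'n) set \<Rightarrow> nat \<Rightarrow> real^'n"
    and m :: nat
  assumes "int CARD('n) simplex T"
    and "normal_frames T \<nu>"
  shows "unisolvent (poly_space m) (DOF T \<nu> m)"
proof -
  obtain C where C: "\<not> affine_dependent C" "card C = CARD('n) + 1" "T = convex hull C"
    using assms(1) unfolding simplex_def by (metis of_nat_1 of_nat_add of_nat_eq_iff)
  note \<nu> = assms(2)[unfolded C(3)]
  let ?D = "DOF (convex hull C) \<nu> m"
  let ?E = "{\<beta> :: 'n \<Rightarrow> nat. (\<Sum>i\<in>UNIV. \<beta> i) \<le> m}"
  let ?\<delta> = "\<lambda>\<beta> \<gamma>. if \<gamma> = \<beta> then 1 else (0 :: real)"
  have fin: "finite ?D" and card: "card ?D \<le> card ?E"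
  proof -
    let ?r = "m mod (CARD('n) + 1)" and ?q = "m div (CARD('n) + 1)"
    have r: "?r < CARD('n) + 1" by (rule mod_less_divisor) simp
    have m: "?r + (CARD('n) + 1) * ?q = m" by (simp only: mod_mult_div_eq)
    note U = card_levels_le[where q = ?q and \<nu> = \<nu>, OF C(1,2) r]
    show "finite ?D" using DOF_subset U(1) by (rule finite_subset)
    have "card ?D \<le> (CARD('n) + m) choose m"
      using card_mono[OF U(1) DOF_subset] U(2) unfolding m by (rule order_trans)
    then show "card ?D \<le> card ?E" by (simp only: card_exponents)
  qed
  \<comment> \<open>The functions \<open>?\<delta> \<beta>\<close> are the coefficients of the
    monomials, so the values of \<open>d\<close> on them form a row of the linear system. The degree
    bound is carried through the induction because \<open>DOF_linear\<close> demands it of both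
    summands.\<close>
  have expand: "deg_le m (\<lambda>\<gamma>. \<Sum>\<beta>\<in>K. x \<beta> * ?\<delta> \<beta> \<gamma>) \<and>
      d (poly_fun m (\<lambda>\<gamma>. \<Sum>\<beta>\<in>K. x \<beta> * ?\<delta> \<beta> \<gamma>)) = (\<Sum>\<beta>\<in>K. d (poly_fun m (?\<delta> \<beta>)) * x \<beta>)"
    if d: "d \<in> ?D" and "finite K" "K \<subseteq> ?E" for d K and x :: "('n \<Rightarrow> nat) \<Rightarrow> real"
    using that(2,3)
  proof (induction K rule: finite_induct)
    case empty
    show ?case using DOF_linear[OF C(1,2) d, of "\<lambda>_. 0" "\<lambda>_. 0" 0 0] by (simp add: deg_le_def)
  next
    case (insert \<beta> K)
    have deg: "deg_le m (?\<delta> \<beta>)" using insert.prems by (auto simp: deg_le_def)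
    have IH: "deg_le m (\<lambda>\<gamma>. \<Sum>\<beta>\<in>K. x \<beta> * ?\<delta> \<beta> \<gamma>)"
      "d (poly_fun m (\<lambda>\<gamma>. \<Sum>\<beta>\<in>K. x \<beta> * ?\<delta> \<beta> \<gamma>)) = (\<Sum>\<beta>\<in>K. d (poly_fun m (?\<delta> \<beta>)) * x \<beta>)"
      using insert.IH insert.prems by auto
    have eq: "(\<lambda>\<gamma>. \<Sum>\<beta>\<in>insert \<beta> K. x \<beta> * ?\<delta> \<beta> \<gamma>) = (\<lambda>\<gamma>. x \<beta> * ?\<delta> \<beta> \<gamma> + 1 * (\<Sum>\<beta>\<in>K. x \<beta> * ?\<delta> \<beta> \<gamma>))"
      using insert.hyps by simp
    have "deg_le m (\<lambda>\<gamma>. x \<beta> * ?\<delta> \<beta> \<gamma> + 1 * (\<Sum>\<beta>\<in>K. x \<beta> * ?\<delta> \<beta> \<gamma>))"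
      using deg IH(1) unfolding deg_le_def by simp
    moreover have "d (poly_fun m (\<lambda>\<gamma>. x \<beta> * ?\<delta> \<beta> \<gamma> + 1 * (\<Sum>\<beta>\<in>K. x \<beta> * ?\<delta> \<beta> \<gamma>))) =
        x \<beta> * d (poly_fun m (?\<delta> \<beta>)) + 1 * d (poly_fun m (\<lambda>\<gamma>. \<Sum>\<beta>\<in>K. x \<beta> * ?\<delta> \<beta> \<gamma>))"
      by (rule DOF_linear[OF C(1,2) d deg IH(1)])
    moreover have "(\<Sum>\<beta>\<in>insert \<beta> K. d (poly_fun m (?\<delta> \<beta>)) * x \<beta>) =
        x \<beta> * d (poly_fun m (?\<delta> \<beta>)) + 1 * (\<Sum>\<beta>\<in>K. d (poly_fun m (?\<delta> \<beta>)) * x \<beta>)"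
      using insert.hyps by simp
    ultimately show ?case unfolding eq IH(2) by simp
  qed
  have delta: "(\<Sum>\<beta>\<in>?E. x \<beta> * ?\<delta> \<beta> \<gamma>) = x \<gamma>" if "\<gamma> \<in> ?E" for x \<gamma>
    using that by (simp add: finite_exponents if_distrib[of "(*) _"] cong: if_cong)
  have degE: "deg_le m (\<lambda>\<gamma>. \<Sum>\<beta>\<in>?E. x \<beta> * ?\<delta> \<beta> \<gamma>)" for x
    unfolding deg_le_def by (auto intro!: sum.neutral)
  have inj: "inj_on (\<lambda>v. \<lambda>d\<in>?D. d v) (poly_space m)"
  proof (rule inj_onI)
    fix u v :: "real^'n \<Rightarrow> real"
    assume "u \<in> poly_space m" "v \<in> poly_space m" and eq: "(\<lambda>d\<in>?D. d u) = (\<lambda>d\<in>?D. d v)"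
    then obtain c e where c: "deg_le m c" "u = poly_fun m c" and e: "deg_le m e" "v = poly_fun m e"
      unfolding poly_space_eq by blast
    \<comment> \<open>The factors 1 and -1 give the difference the shape required by
      \<open>DOF_linear\<close>.\<close>
    have "1 * c \<beta> + (- 1) * e \<beta> = 0" for \<beta>
    proof (rule DOF_kernel_trivial[OF C(1,2) \<nu> ballI])
      fix d assume d: "d \<in> ?D"
      have "d u = d v" using eq d by (metis restrict_apply')
      then show "d (poly_fun m (\<lambda>\<beta>. 1 * c \<beta> + (- 1) * e \<beta>)) = 0"
        unfolding DOF_linear[OF C(1,2) d c(1) e(1)] c(2) e(2) by simp
    next
      show "deg_le m (\<lambda>\<beta>. 1 * c \<beta> + (- 1) * e \<beta>)" using c(1) e(1) by (simp add: deg_le_def)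
    qed
    then have "c = e" by (simp add: fun_eq_iff)
    then show "u = v" using c e by simp
  qed
  have "\<exists>v\<in>poly_space m. (\<lambda>d\<in>?D. d v) = t" if t: "t \<in> ?D \<rightarrow>\<^sub>E UNIV" for t
  proof -
    \<comment> \<open>Interpolation as a linear system with one equation for each functional and one
      unknown for each exponent; the kernel lemma that gave injectivity now supplies
      solvability.\<close>
    have "\<exists>x. \<forall>d\<in>?D. (\<Sum>\<beta>\<in>?E. d (poly_fun m (?\<delta> \<beta>)) * x \<beta>) = t d"
    proof (rule linear_system_solvable[OF fin finite_exponents card])
      fix x assume "\<And>d. d \<in> ?D \<Longrightarrow> (\<Sum>\<beta>\<in>?E. d (poly_fun m (?\<delta> \<beta>)) * x \<beta>) = 0"
      then have "d (poly_fun m (\<lambda>\<gamma>. \<Sum>\<beta>\<in>?E. x \<beta> * ?\<delta> \<beta> \<gamma>)) = 0" if "d \<in> ?D" for d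
        using expand[OF that finite_exponents order_refl] that by simp
      then have zero: "(\<Sum>\<beta>\<in>?E. x \<beta> * ?\<delta> \<beta> \<gamma>) = 0" for \<gamma>
        by (intro DOF_kernel_trivial[OF C(1,2) \<nu> _ degE] ballI)
      show "\<forall>\<gamma>\<in>?E. x \<gamma> = 0"
      proof
        fix \<gamma> assume "\<gamma> \<in> ?E"
        from delta[OF this, of x] show "x \<gamma> = 0" unfolding zero by simp
      qed
    qed
    then obtain x where x: "\<And>d. d \<in> ?D \<Longrightarrow> (\<Sum>\<beta>\<in>?E. d (poly_fun m (?\<delta> \<beta>)) * x \<beta>) = t d" by blast
    let ?v = "poly_fun m (\<lambda>\<gamma>. \<Sum>\<beta>\<in>?E. x \<beta> * ?\<delta> \<beta> \<gamma>)"
    have "d ?v = t d" if "d \<in> ?D" for d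
      using expand[OF that finite_exponents order_refl] x[OF that] by simp
    then have "(\<lambda>d\<in>?D. d ?v) = t" using t by (intro ext) (auto simp: restrict_def PiE_def extensional_def)
    moreover have "?v \<in> poly_space m" unfolding poly_space_eq using degE by blast
    ultimately show ?thesis by blast
  qed
  then have "?D \<rightarrow>\<^sub>E UNIV \<subseteq> (\<lambda>v. \<lambda>d\<in>?D. d v) ` poly_space m"
    unfolding image_def by (intro subsetI CollectI) (simp only: eq_commute)
  then have "(\<lambda>v. \<lambda>d\<in>?D. d v) ` poly_space m = ?D \<rightarrow>\<^sub>E UNIV" by (intro equalityI) auto
  then show ?thesis using inj unfolding unisolvent_def bij_betw_def C(3) by simp
qed

end
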